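(* Let $P\supset B$ be the standard parabolic subgroup of $G=SL_n(\mathbf k)$ attached to $0=d_0<d_1<\cdots<d_r=n$, and let $\kappa\in\widehat W$ be the element with affine permutation matrix $$\kappa=\sum_{i=1}^{s}t^{\nu_i-1}E_{i,l(i)}+\sum_{i=1}^{n-s}t^{-1}E_{i+s,m(i)} .$$ The length of $\kappa$ is given by the formula $$l(\kappa)=2\dim G/P+\sum_{1\le k'<k\le r}\#\mathrm{Row}(k)\,\#\mathrm{Blue}(k').$$
   Context: Let $\mathbf k$ be an algebraically closed field, $G=SL_n(\mathbf k)$, $B\subset G$ the upper triangular matrices, $T$ the diagonal torus, $\alpha_1,\dots,\alpha_{n-1}$ the simple roots, $W=S_n$ the Weyl group. $E_{i,j}$ is the elementary $n\times n$ matrix with $1$ in position $(i,j)$. The affine Weyl group $\widehat W$ is $N(\mathbf k[t,t^{-1}])/T$, where $N$ is the normalizer of $T$ in $G$; by replacing the nonzero coefficients of monomial matrices by $1$ it is identified with the group of affine permutation matrices $\sum_i t^{c_i}E_{\sigma(i),i}$ with $\sigma\in S_n$, $c_i\in\mathbb Z$, $\sum c_i=0$. $W$ is the subgroup of permutation matrices $\sum E_{w(i),i}$. $\widehat W$ is a Coxeter group with generators $s_1,\dots,s_{n-1}$ (simple transpositions $s_i=(i,i+1)$ in $W$) and $s_0=t^{-1}E_{1,n}+tE_{n,1}+\sum_{1<i<n}E_{i,i}$; $l(w)$, for $w\in\widehat W$, denotes the Coxeter length with respect to these generators. Given $0=d_0<d_1<\cdots<d_r=n$, put $\lambda_i=d_i-d_{i-1}$.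 $P\supset B$ is the parabolic subgroup of $G$ corresponding to $\{\alpha_1,\dots,\alpha_{n-1}\}\setminus\{\alpha_{d_i}:1\le i<r\}$ (block upper triangular matrices with diagonal blocks of sizes $\lambda_1,\dots,\lambda_r$). Tableau data. Let $\nu=(\nu_1,\dots,\nu_s)$ be the partition of $n$ conjugate to the decreasing rearrangement of $(\lambda_1,\dots,\lambda_r)$; so $s=\max_i\lambda_i$ and $\nu_j=\#\{i:\lambda_i\ge j\}$. Consider the left-aligned tableau with $r$ rows whose $i$-th row from the top has $\lambda_i$ boxes, filled in increasing order with $\mathrm{Row}(i)=\{k: d_{i-1}<k\le d_i\}$. Set $\mathrm{Red}(i)=\{j: d_{i-1}<j\le d_i-\max\{\lambda_{i'}: i'<i\}\}$ (maximum of the empty set being $0$), $\mathrm{Blue}(i)=\mathrm{Row}(i)\setminus\mathrm{Red}(i)$, $\mathrm{Red}=\bigcup_i\mathrm{Red}(i)$, $\mathrm{Blue}=\bigcup_i\mathrm{Blue}(i)$. The set $\mathrm{Red}$ has $s$ elements, written in increasing order as $l(1),\dots,l(s)$ (the notation $l(i)$ for these integers is unrelated to the length function). The elements of $\mathrm{Blue}$, enumerated row by row from the bottom row to the top row, each row from left to right, are $m(1),\dots,m(n-s)$. *)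

theory Defs
  imports
    "Jordan_Normal_Form.Determinant"
    "HOL-Algebra.Left_Coset"
    "HOL-Analysis.Abstract_Topology"
    "HOL-Combinatorics.Permutations"
    "HOL-Library.Extended_Nat"
    "HOL-Computational_Algebra.Formal_Laurent_Series"
begin

text \<open>
  Rows, columns and all combinatorial indices are numbered from 1 as in the mathematics;
  the entry of a matrix \<open>A\<close> in row \<open>i\<close> and column \<open>j\<close> is therefore \<open>A $$ (i - 1, j - 1)\<close>.
\<close>

section \<open>Zariski topology and dimension\<close>

inductive_set poly_funs :: "nat \<Rightarrow> ('k::field mat \<Rightarrow> 'k) set" for n :: nat where
  const: "(\<lambda>A. c) \<in> poly_funs n"
| coord: "i < n \<Longrightarrow> j < n \<Longrightarrow> (\<lambda>A. A $$ (i, j)) \<in> poly_funs n"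
| add: "f \<in> poly_funs n \<Longrightarrow> g \<in> poly_funs n \<Longrightarrow> (\<lambda>A. f A + g A) \<in> poly_funs n"
| mult: "f \<in> poly_funs n \<Longrightarrow> g \<in> poly_funs n \<Longrightarrow> (\<lambda>A. f A * g A) \<in> poly_funs n"

definition zariski_open :: "nat \<Rightarrow> 'k::field mat set \<Rightarrow> bool" where
  "zariski_open n U \<longleftrightarrow>
     (\<exists>F \<subseteq> poly_funs n. U = carrier_mat n n - {A \<in> carrier_mat n n. \<forall>f\<in>F. f A = 0})"

definition zariski :: "nat \<Rightarrow> 'k::field mat topology" where
  "zariski n = topology (zariski_open n)"

lemma istopology_zariski_open: "istopology (zariski_open n :: 'k::field mat set \<Rightarrow> bool)"
  unfolding istopology_def
proof (intro conjI allI impI)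
  fix S T :: "'k mat set"
  assume "zariski_open n S" "zariski_open n T"
  then obtain F H where F: "F \<subseteq> poly_funs n"
      "S = carrier_mat n n - {A \<in> carrier_mat n n. \<forall>f\<in>F. f A = 0}"
    and H: "H \<subseteq> poly_funs n"
      "T = carrier_mat n n - {A \<in> carrier_mat n n. \<forall>f\<in>H. f A = 0}"
    unfolding zariski_open_def by blast
  let ?K = "{(\<lambda>A. f A * h A) | f h. f \<in> F \<and> h \<in> H}"
  have "?K \<subseteq> poly_funs n"
    using F(1) H(1) by (auto intro: poly_funs.mult)
  moreover have "S \<inter> T = carrier_mat n n - {A \<in> carrier_mat n n. \<forall>f\<in>?K. f A = 0}"
  proof (intro subset_antisym subsetI)
    fix A assume "A \<in> S \<inter> T"
    then have A: "A \<in> carrier_mat n n" and "\<exists>f\<in>F. f A \<noteq> 0" "\<exists>h\<in>H. h A \<noteq> 0"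
      unfolding F(2) H(2) by simp_all
    then obtain f h where fh: "f \<in> F" "f A \<noteq> 0" "h \<in> H" "h A \<noteq> 0"
      by (elim bexE)
    have "(\<lambda>A. f A * h A) \<in> ?K"
      using fh(1,3) by (intro CollectI, rule_tac exI[of _ f], rule_tac exI[of _ h]) simp
    moreover have "f A * h A \<noteq> 0"
      using fh(2,4) by simp
    ultimately have "\<not> (\<forall>f\<in>?K. f A = 0)"
      by (meson bspec)
    with A show "A \<in> carrier_mat n n - {A \<in> carrier_mat n n. \<forall>f\<in>?K. f A = 0}"
      by simp
  next
    fix A assume "A \<in> carrier_mat n n - {A \<in> carrier_mat n n. \<forall>f\<in>?K. f A = 0}"
    then have A: "A \<in> carrier_mat n n" and "\<exists>f\<in>?K. f A \<noteq> 0"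
      by simp_all
    then obtain f h where "f \<in> F" "h \<in> H" "f A * h A \<noteq> 0"
      by (elim bexE CollectE exE conjE) simp
    then have "\<exists>f\<in>F. f A \<noteq> 0" "\<exists>h\<in>H. h A \<noteq> 0"
      by (metis mult_zero_left, metis mult_zero_right)
    with A show "A \<in> S \<inter> T"
      unfolding F(2) H(2) by simp
  qed
  ultimately show "zariski_open n (S \<inter> T)"
    unfolding zariski_open_def by (intro exI[of _ ?K] conjI)
next
  fix \<K> :: "'k mat set set"
  assume "\<forall>K\<in>\<K>. zariski_open n K"
  then have K: "zariski_open n K" if "K \<in> \<K>" for K
    using that by blast
  let ?F = "{f \<in> poly_funs n. {A \<in> carrier_mat n n. f A \<noteq> 0} \<subseteq> \<Union>\<K>}"
  have "A \<in> carrier_mat n n \<and> (\<exists>f\<in>?F. f A \<noteq> 0)" if A: "A \<in> \<Union>\<K>" for A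
  proof -
    obtain K where "K \<in> \<K>" "A \<in> K"
      using A by blast
    obtain F where F: "F \<subseteq> poly_funs n"
        "K = carrier_mat n n - {A \<in> carrier_mat n n. \<forall>f\<in>F. f A = 0}"
      using K[OF \<open>K \<in> \<K>\<close>] unfolding zariski_open_def by blast
    have "A \<in> carrier_mat n n" "\<exists>f\<in>F. f A \<noteq> 0"
      using \<open>A \<in> K\<close> unfolding F(2) by simp_all
    then obtain f where f: "f \<in> F" "f A \<noteq> 0"
      by blast
    have "{A \<in> carrier_mat n n. f A \<noteq> 0} \<subseteq> K"
      unfolding F(2) using f(1) by blast
    then have "{A \<in> carrier_mat n n. f A \<noteq> 0} \<subseteq> \<Union>\<K>"
      using \<open>K \<in> \<K>\<close> by (meson Union_upper subset_trans)
    then have "f \<in> ?F"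
      using f(1) F(1) by (simp add: subset_iff)
    then show ?thesis
      using \<open>A \<in> carrier_mat n n\<close> f(2) by blast
  qed
  moreover have "A \<in> \<Union>\<K>" if "A \<in> carrier_mat n n" "\<exists>f\<in>?F. f A \<noteq> 0" for A
    using that by blast
  ultimately have "A \<in> \<Union>\<K> \<longleftrightarrow> A \<in> carrier_mat n n \<and> (\<exists>f\<in>?F. f A \<noteq> 0)" for A
    by (intro iffI) (assumption | elim conjE)+
  then have "\<Union>\<K> = carrier_mat n n - {A \<in> carrier_mat n n. \<forall>f\<in>?F. f A = 0}"
    by (intro equalityI subsetI) simp_all
  moreover have "?F \<subseteq> poly_funs n"
    by (rule Collect_restrict)
  ultimately show "zariski_open n (\<Union>\<K>)"
    unfolding zariski_open_def by (intro exI[of _ ?F] conjI)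
qed

lemma openin_zariski: "openin (zariski n) = zariski_open n"
  unfolding zariski_def by (rule topology_inverse'[OF istopology_zariski_open])

definition quotient_space :: "'a topology \<Rightarrow> ('a \<Rightarrow> 'b) \<Rightarrow> 'b topology" where
  "quotient_space X q =
     topology (\<lambda>U. U \<subseteq> q ` topspace X \<and> openin X {x \<in> topspace X. q x \<in> U})"

lemma openin_quotient_space:
  "openin (quotient_space X q) U \<longleftrightarrow>
     U \<subseteq> q ` topspace X \<and> openin X {x \<in> topspace X. q x \<in> U}"
proof -
  have "istopology (\<lambda>U. U \<subseteq> q ` topspace X \<and> openin X {x \<in> topspace X. q x \<in> U})"
    unfolding istopology_def
  proof (intro conjI allI impI; (elim conjE)?)
    fix S T
    assume "openin X {x \<in> topspace X. q x \<in> S}" "openin X {x \<in> topspace X. q x \<in> T}"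
    then have "openin X ({x \<in> topspace X. q x \<in> S} \<inter> {x \<in> topspace X. q x \<in> T})"
      by blast
    moreover have "{x \<in> topspace X. q x \<in> S} \<inter> {x \<in> topspace X. q x \<in> T}
        = {x \<in> topspace X. q x \<in> S \<inter> T}"
      by blast
    ultimately show "openin X {x \<in> topspace X. q x \<in> S \<inter> T}"
      by simp
  next
    fix \<K>
    assume "\<forall>K\<in>\<K>. K \<subseteq> q ` topspace X \<and> openin X {x \<in> topspace X. q x \<in> K}"
    then have "openin X (\<Union>K\<in>\<K>. {x \<in> topspace X. q x \<in> K})"
      by blast
    moreover have "(\<Union>K\<in>\<K>. {x \<in> topspace X. q x \<in> K}) = {x \<in> topspace X. q x \<in> \<Union>\<K>}"
      by blast
    ultimately show "openin X {x \<in> topspace X. q x \<in> \<Union>\<K>}"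
      by simp
  qed blast+
  then show ?thesis
    unfolding quotient_space_def by (simp add: topology_inverse')
qed

definition irreducible_closed :: "'a topology \<Rightarrow> 'a set \<Rightarrow> bool" where
  "irreducible_closed X Z \<longleftrightarrow> closedin X Z \<and> Z \<noteq> {} \<and>
     (\<forall>C D. closedin X C \<longrightarrow> closedin X D \<longrightarrow> Z = C \<union> D \<longrightarrow> Z = C \<or> Z = D)"

definition krull_dim :: "'a topology \<Rightarrow> enat" where
  "krull_dim X = Sup {enat m | m. \<exists>Z. (\<forall>i\<le>m. irreducible_closed X (Z i)) \<and>
                                     (\<forall>i<m. Z i \<subset> Z (Suc i))}"

section \<open>Special linear group, parabolic subgroup and partial flag variety\<close>

definition SL :: "nat \<Rightarrow> 'k::field mat monoid" where
  "SL n = \<lparr>carrier = {A \<in> carrier_mat n n. det A = 1}, mult = (*), one = 1\<^sub>m n\<rparr>"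

definition Row :: "(nat \<Rightarrow> nat) \<Rightarrow> nat \<Rightarrow> nat set" where
  "Row d i = {d (i - 1)<..d i}"

definition parabolic :: "nat \<Rightarrow> nat \<Rightarrow> (nat \<Rightarrow> nat) \<Rightarrow> 'k::field mat set" where
  "parabolic n r d = {A \<in> carrier (SL n).
     \<forall>k\<in>{1..r}. \<forall>k'\<in>{1..<k}. \<forall>a\<in>Row d k. \<forall>b\<in>Row d k'. A $$ (a - 1, b - 1) = 0}"

text \<open>
  The topological space underlying the variety \<open>G/P\<close> is the set of left cosets
  with the quotient of the Zariski topology of \<open>G\<close>.
\<close>

definition coset_space :: "nat \<Rightarrow> 'k::field mat set \<Rightarrow> 'k mat set topology" where
  "coset_space n P =
     quotient_space (subtopology (zariski n) (carrier (SL n))) (\<lambda>A. A <#\<^bsub>SL n\<^esub> P)"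

section \<open>Affine permutation matrices and length\<close>

definition Emat :: "nat \<Rightarrow> nat \<Rightarrow> nat \<Rightarrow> 'a::zero_neq_one mat" where
  "Emat n i j = mat n n (\<lambda>(a, b). if a + 1 = i \<and> b + 1 = j then 1 else 0)"

definition tE :: "nat \<Rightarrow> int \<Rightarrow> nat \<Rightarrow> nat \<Rightarrow> 'k::field fls mat" where
  "tE n c i j = fls_X_intpow c \<cdot>\<^sub>m Emat n i j"

definition mat_sum :: "nat \<Rightarrow> ('i \<Rightarrow> 'a::semiring_1 mat) \<Rightarrow> 'i set \<Rightarrow> 'a mat" where
  "mat_sum n f I = finsum (module_mat TYPE('a) n n) f I"

text \<open>
  All entries of these matrices lie in \<open>k[t, t\<^sup>-\<^sup>1]\<close>, regarded as a subring of the field of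
  formal Laurent series.
\<close>

definition affine_weyl :: "nat \<Rightarrow> 'k::field fls mat monoid" where
  "affine_weyl n =
     \<lparr>carrier = {mat_sum n (\<lambda>i. tE n (c i) (\<sigma> i) i) {1..n} | c \<sigma>.
                   \<sigma> permutes {1..n} \<and> (\<Sum>i=1..n. c i) = 0},
      mult = (*), one = 1\<^sub>m n\<rparr>"

definition simple_refl :: "nat \<Rightarrow> nat \<Rightarrow> 'k::field fls mat" where
  "simple_refl n i =
     (if i = 0 then tE n (-1) 1 n + tE n 1 n 1 + mat_sum n (\<lambda>j. Emat n j j) {1<..<n}
      else mat_sum n (\<lambda>j. Emat n (Transposition.transpose i (i + 1) j) j) {1..n})"

text \<open>
  For \<open>n = 1\<close> the affine Weyl group is trivial and there are no generators: the formula for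
  \<open>s\<^sub>0\<close> makes sense only for \<open>n \<ge> 2\<close>.
\<close>

definition simple_refls :: "nat \<Rightarrow> 'k::field fls mat set" where
  "simple_refls n = (if n < 2 then {} else simple_refl n ` {0..<n})"

definition word_length :: "('a, 'b) monoid_scheme \<Rightarrow> 'a set \<Rightarrow> 'a \<Rightarrow> nat" where
  "word_length G S w = (LEAST k. \<exists>ws. length ws = k \<and> set ws \<subseteq> S \<and>
                                      foldr (\<lambda>x y. x \<otimes>\<^bsub>G\<^esub> y) ws \<one>\<^bsub>G\<^esub> = w)"

definition coxeter_length :: "nat \<Rightarrow> 'k::field fls mat \<Rightarrow> nat" where
  "coxeter_length n w = word_length (affine_weyl n) (simple_refls n) w"

section \<open>Tableau data\<close>

definition row_len :: "(nat \<Rightarrow> nat) \<Rightarrow> nat \<Rightarrow> nat" where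
  "row_len d i = d i - d (i - 1)"

definition ncols :: "nat \<Rightarrow> (nat \<Rightarrow> nat) \<Rightarrow> nat" where
  "ncols r d = Max (row_len d ` {1..r})"

definition col_len :: "nat \<Rightarrow> (nat \<Rightarrow> nat) \<Rightarrow> nat \<Rightarrow> nat" where
  "col_len r d j = card {i \<in> {1..r}. row_len d i \<ge> j}"

text \<open>
  In \<open>Red\<close> the bound \<open>j \<le> d\<^sub>i - max\<close> is written additively, because the difference may be
  negative; inserting 0 gives the convention \<open>max {} = 0\<close>.
\<close>

definition Red :: "(nat \<Rightarrow> nat) \<Rightarrow> nat \<Rightarrow> nat set" where
  "Red d i = {j. d (i - 1) < j \<and> j + Max (insert 0 (row_len d ` {1..<i})) \<le> d i}"

definition Blue :: "(nat \<Rightarrow> nat) \<Rightarrow> nat \<Rightarrow> nat set" where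
  "Blue d i = Row d i - Red d i"

definition red_enum :: "nat \<Rightarrow> (nat \<Rightarrow> nat) \<Rightarrow> nat \<Rightarrow> nat" where
  "red_enum r d i = sorted_list_of_set (\<Union>k\<in>{1..r}. Red d k) ! (i - 1)"

definition blue_enum :: "nat \<Rightarrow> (nat \<Rightarrow> nat) \<Rightarrow> nat \<Rightarrow> nat" where
  "blue_enum r d i =
     concat (map (\<lambda>k. sorted_list_of_set (Blue d k)) (rev [1..<r + 1])) ! (i - 1)"

end

theory Submission
  imports Defs
begin

text \<open>
  The formula compares a combinatorial number with a dimension, and both sides are computed
  independently.

  Length. Writing an affine permutation matrix row by row as \<open>\<Sum>\<^sub>p t\<^bsup>b(p)\<^esup> E(p, \<tau> p)\<close>,
  its length is the number of affine inversions
  \<open>\<Sum> \<bar>b p - b q + [\<tau> p > \<tau> q]\<bar>\<close> over \<open>p < q\<close>: left multiplication by a simple reflection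
  permutes all but one of the summands up to sign and changes the remaining one so that the sum
  moves by exactly one, and an element without descent is the identity
  (\<open>coxeter_length_monomial_mat\<close>). For \<open>\<kappa>\<close> the exponents are \<open>b p = \<nu>\<^sub>p - 1\<close> for all \<open>p\<close>, since
  \<open>\<nu>\<^sub>p = 0\<close> beyond the number of columns. They decrease with \<open>p\<close>, so every absolute value can be
  dropped and the length splits into \<open>\<Sum> (\<nu>\<^sub>p - \<nu>\<^sub>q)\<close> and the number of inversions of the word
  \<open>l(1), \<dots>, l(s), m(1), \<dots>, m(n - s)\<close>. The inversions of this word are the pairs formed by a blue
  box and any box of a lower row, which gives the double sum over rows. The first sum is
  \<open>n\<^sup>2 - \<Sum> \<lambda>\<^sub>k\<^sup>2 = 2 \<Sum> \<lambda>\<^sub>k \<lambda>\<^sub>k\<^sub>'\<close> because \<open>\<Sum> \<nu>\<^sub>j (2j - 1) = \<Sum> \<lambda>\<^sub>k\<^sup>2\<close>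
  (\<open>kappa_length\<close>).

  Dimension. It remains to see that \<open>G/P\<close> has Krull dimension
  \<open>N = \<Sum> \<lambda>\<^sub>k \<lambda>\<^sub>k\<^sub>'\<close>, summed over \<open>k' < k\<close>. The translates of the big cell, whose points are the
  cosets of block lower unitriangular matrices, cover \<open>G/P\<close>, and each is an affine space with \<open>N\<close>
  coordinates. These coordinates are quotients of polynomials in the matrix entries by leading
  minors, so hypersurfaces of a cell extend to closed subsets of \<open>G/P\<close>. That is enough to
  transport chains of irreducible closed sets between \<open>G/P\<close> and affine space (\<open>affine_atlas\<close>).
  Coordinate subspaces give a chain of length \<open>N\<close>. Conversely, for a chain
  \<open>Y\<^sub>0 \<subset> \<dots> \<subset> Y\<^sub>m\<close> choose \<open>f\<^sub>i\<close> vanishing on \<open>Y\<^sub>i\<close> but not on \<open>Y\<^sub>i\<^sub>+\<^sub>1\<close>: these functions are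
  algebraically independent, and counting monomials of bounded degree shows that more than \<open>N\<close>
  polynomials in \<open>N\<close> variables never are (\<open>prime_chain_length_le\<close>).
\<close>

section \<open>Algebraic dependence of polynomial functions\<close>

text \<open>
  Gaussian elimination: one equation is solved for an unknown that occurs in it, and substituting
  the solution leaves one equation and one unknown fewer.
\<close>

lemma homogeneous_system_nontrivial:
  fixes k :: "'a \<Rightarrow> 'b \<Rightarrow> 'k::field"
  assumes "finite M" "finite A" "card M < card A"
  shows "\<exists>c. (\<exists>a\<in>A. c a \<noteq> 0) \<and> (\<forall>\<mu>\<in>M. (\<Sum>a\<in>A. c a * k a \<mu>) = 0)"
  using assms
proof (induction M arbitrary: A k rule: finite_induct)
  case empty
  then have "A \<noteq> {}" by auto
  then show ?case by (intro exI[of _ "\<lambda>_. 1"]) auto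
next
  case (insert \<mu> M)
  show ?case
  proof (cases "\<forall>a\<in>A. k a \<mu> = 0")
    case True
    obtain c where "\<exists>a\<in>A. c a \<noteq> 0" "\<forall>\<nu>\<in>M. (\<Sum>a\<in>A. c a * k a \<nu>) = 0"
      using insert.IH[OF insert.prems(1), of k] insert.prems insert.hyps by auto
    then show ?thesis using True by (intro exI[of _ c]) (auto intro: sum.neutral)
  next
    case False
    then obtain a0 where a0: "a0 \<in> A" "k a0 \<mu> \<noteq> 0" by blast
    define k' where "k' = (\<lambda>a \<nu>. k a \<nu> - k a \<mu> / k a0 \<mu> * k a0 \<nu>)"
    have "card M < card (A - {a0})" using insert.prems insert.hyps a0 by (simp add: card_Diff_singleton)
    then obtain c where c: "\<exists>a\<in>A - {a0}. c a \<noteq> 0" "\<forall>\<nu>\<in>M. (\<Sum>a\<in>A - {a0}. c a * k' a \<nu>) = 0"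
      using insert.IH[of "A - {a0}" k'] insert.prems by auto
    define x where "x = - (\<Sum>a\<in>A - {a0}. c a * k a \<mu>) / k a0 \<mu>"
    have split: "(\<Sum>a\<in>A. (c(a0 := x)) a * k a \<nu>) = x * k a0 \<nu> + (\<Sum>a\<in>A - {a0}. c a * k a \<nu>)" for \<nu>
    proof -
      have "(\<Sum>a\<in>A - {a0}. (c(a0 := x)) a * k a \<nu>) = (\<Sum>a\<in>A - {a0}. c a * k a \<nu>)"
        by (rule sum.cong) auto
      then show ?thesis using a0 insert.prems by (subst sum.remove[of A a0]) auto
    qed
    have "(\<Sum>a\<in>A. (c(a0 := x)) a * k a \<nu>) = (\<Sum>a\<in>A - {a0}. c a * k' a \<nu>)" for \<nu>
      unfolding split unfolding x_def k'_def
      by (simp add: right_diff_distrib sum_subtractf sum_divide_distrib sum_distrib_right mult.assoc)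
    moreover have "k' a \<mu> = 0" for a using a0 by (simp add: k'_def)
    ultimately have "\<forall>\<nu>\<in>insert \<mu> M. (\<Sum>a\<in>A. (c(a0 := x)) a * k a \<nu>) = 0"
      using c(2) by simp
    moreover have "\<exists>a\<in>A. (c(a0 := x)) a \<noteq> 0" using c(1) by auto
    ultimately show ?thesis by blast
  qed
qed

text \<open>
  Polynomial functions in the variables \<open>I\<close>. They are functions on all maps \<open>'i \<Rightarrow> 'k\<close>, so that a
  space of dimension \<open>card I\<close> needs no type of its own.
\<close>

inductive_set poly_maps :: "'i set \<Rightarrow> (('i \<Rightarrow> 'k::field) \<Rightarrow> 'k) set" for I :: "'i set" where
  poly_maps_const: "(\<lambda>y. c) \<in> poly_maps I"
| poly_maps_var: "i \<in> I \<Longrightarrow> (\<lambda>y. y i) \<in> poly_maps I"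
| poly_maps_add: "f \<in> poly_maps I \<Longrightarrow> g \<in> poly_maps I \<Longrightarrow> (\<lambda>y. f y + g y) \<in> poly_maps I"
| poly_maps_mult: "f \<in> poly_maps I \<Longrightarrow> g \<in> poly_maps I \<Longrightarrow> (\<lambda>y. f y * g y) \<in> poly_maps I"

lemma poly_maps_sum: "finite A \<Longrightarrow> (\<And>a. a \<in> A \<Longrightarrow> f a \<in> poly_maps I) \<Longrightarrow> (\<lambda>y. \<Sum>a\<in>A. f a y) \<in> poly_maps I"
  by (induction A rule: finite_induct) (auto intro: poly_maps.intros)

lemma poly_maps_prod: "finite A \<Longrightarrow> (\<And>a. a \<in> A \<Longrightarrow> f a \<in> poly_maps I) \<Longrightarrow> (\<lambda>y. \<Prod>a\<in>A. f a y) \<in> poly_maps I"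
  by (induction A rule: finite_induct) (auto intro: poly_maps.intros)

lemma poly_maps_power: "f \<in> poly_maps I \<Longrightarrow> (\<lambda>y. f y ^ k) \<in> poly_maps I"
  by (induction k) (auto intro: poly_maps.intros)

lemma poly_maps_cong: "f \<in> poly_maps I \<Longrightarrow> (\<And>i. i \<in> I \<Longrightarrow> y i = z i) \<Longrightarrow> f y = f z"
  by (induction rule: poly_maps.induct) auto

definition exponents :: "'i set \<Rightarrow> nat \<Rightarrow> ('i \<Rightarrow> nat) set" where
  "exponents I D = I \<rightarrow>\<^sub>E {..D}"

text \<open>
  The degree is bounded in each variable separately: the exponent vectors then form a product set,
  and their number \<open>(D + 1)\<^bsup>card I\<^esup>\<close> needs no binomial coefficients.
\<close>

definition degrees_le :: "'i set \<Rightarrow> nat \<Rightarrow> (('i \<Rightarrow> 'k::field) \<Rightarrow> 'k) \<Rightarrow> bool" where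
  "degrees_le I D f \<longleftrightarrow> (\<exists>k. \<forall>y. f y = (\<Sum>e\<in>exponents I D. k e * (\<Prod>i\<in>I. y i ^ e i)))"

lemma finite_exponents: "finite I \<Longrightarrow> finite (exponents I D)"
  unfolding exponents_def by (rule finite_PiE) auto

lemma card_exponents: "finite I \<Longrightarrow> card (exponents I D) = (D + 1) ^ card I"
  unfolding exponents_def by (simp add: card_PiE)

lemma degrees_le_monom:
  assumes "finite I" "\<And>i. i \<in> I \<Longrightarrow> e i \<le> D"
  shows "degrees_le I D (\<lambda>y. \<Prod>i\<in>I. y i ^ e i)"
  unfolding degrees_le_def
proof (intro exI allI)
  fix y :: "'a \<Rightarrow> 'b"
  let ?e = "restrict e I"
  have e: "?e \<in> exponents I D" using assms(2) by (auto simp: exponents_def)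
  have "(\<Sum>e'\<in>exponents I D. of_bool (e' = ?e) * (\<Prod>i\<in>I. y i ^ e' i)) = (\<Prod>i\<in>I. y i ^ ?e i)"
    using e finite_exponents[OF assms(1), of D] sum.delta[of "exponents I D" ?e "\<lambda>e'. \<Prod>i\<in>I. y i ^ e' i"]
    by (simp add: of_bool_def if_distrib[of "\<lambda>x. x * _"] cong: if_cong)
  then show "(\<Prod>i\<in>I. y i ^ e i) = (\<Sum>e'\<in>exponents I D. of_bool (e' = ?e) * (\<Prod>i\<in>I. y i ^ e' i))"
    by simp
qed

lemma degrees_le_add:
  assumes "degrees_le I D f" "degrees_le I D g"
  shows "degrees_le I D (\<lambda>y. f y + g y)"
proof -
  obtain k k' where "\<forall>y. f y = (\<Sum>e\<in>exponents I D. k e * (\<Prod>i\<in>I. y i ^ e i))"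
      "\<forall>y. g y = (\<Sum>e\<in>exponents I D. k' e * (\<Prod>i\<in>I. y i ^ e i))"
    using assms unfolding degrees_le_def by blast
  then show ?thesis
    unfolding degrees_le_def by (intro exI[of _ "\<lambda>e. k e + k' e"]) (simp add: distrib_right sum.distrib)
qed

lemma degrees_le_scale:
  assumes "degrees_le I D f"
  shows "degrees_le I D (\<lambda>y. c * f y)"
proof -
  obtain k where "\<forall>y. f y = (\<Sum>e\<in>exponents I D. k e * (\<Prod>i\<in>I. y i ^ e i))"
    using assms unfolding degrees_le_def by blast
  then show ?thesis
    unfolding degrees_le_def by (intro exI[of _ "\<lambda>e. c * k e"]) (simp add: sum_distrib_left mult.assoc)
qed

lemma degrees_le_sum:
  "finite A \<Longrightarrow> (\<And>a. a \<in> A \<Longrightarrow> degrees_le I D (f a)) \<Longrightarrow> degrees_le I D (\<lambda>y. \<Sum>a\<in>A. f a y)"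
proof (induction A rule: finite_induct)
  case empty
  show ?case unfolding degrees_le_def by (intro exI[of _ "\<lambda>_. 0"]) simp
next
  case (insert a A)
  then show ?case using degrees_le_add[of I D "f a" "\<lambda>y. \<Sum>a\<in>A. f a y"] by simp
qed

lemma degrees_le_mult:
  assumes "finite I" "degrees_le I D f" "degrees_le I E g"
  shows "degrees_le I (D + E) (\<lambda>y. f y * g y)"
proof -
  obtain k k' where "\<forall>y. f y = (\<Sum>e\<in>exponents I D. k e * (\<Prod>i\<in>I. y i ^ e i))"
      "\<forall>y. g y = (\<Sum>e\<in>exponents I E. k' e * (\<Prod>i\<in>I. y i ^ e i))"
    using assms(2,3) unfolding degrees_le_def by blast
  then have k: "f y = (\<Sum>e\<in>exponents I D. k e * (\<Prod>i\<in>I. y i ^ e i))"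
      "g y = (\<Sum>e\<in>exponents I E. k' e * (\<Prod>i\<in>I. y i ^ e i))" for y
    by auto
  have eq: "f y * g y = (\<Sum>e\<in>exponents I D. \<Sum>e'\<in>exponents I E. k e * (k' e' * (\<Prod>i\<in>I. y i ^ (e i
      + e' i))))" for y
    unfolding k sum_product
    by (rule sum.cong[OF refl], rule sum.cong[OF refl]) (simp add: power_add prod.distrib mult_ac)
  have monom: "degrees_le I (D + E) (\<lambda>y. \<Prod>i\<in>I. y i ^ (e i + e' i))"
    if "e \<in> exponents I D" "e' \<in> exponents I E" for e e'
    by (rule degrees_le_monom[OF assms(1)]) (use that in \<open>auto simp: exponents_def intro!: add_mono\<close>)
  show ?thesis
    unfolding eq
    by (rule degrees_le_sum[OF finite_exponents[OF assms(1)]], rule degrees_le_sum[OF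
        finite_exponents[OF assms(1)]],
        rule degrees_le_scale, rule degrees_le_scale, rule monom)
qed

lemma degrees_le_mono:
  assumes "finite I" "degrees_le I D f" "D \<le> E"
  shows "degrees_le I E f"
proof -
  obtain k where "\<forall>y. f y = (\<Sum>e\<in>exponents I D. k e * (\<Prod>i\<in>I. y i ^ e i))"
    using assms(2) unfolding degrees_le_def by blast
  then have k: "f y = (\<Sum>e\<in>exponents I D. k e * (\<Prod>i\<in>I. y i ^ e i))" for y by simp
  have monom: "degrees_le I E (\<lambda>y. \<Prod>i\<in>I. y i ^ e i)" if "e \<in> exponents I D" for e
    by (rule degrees_le_monom[OF assms(1)])
      (use that assms(3) in \<open>auto simp: exponents_def PiE_def Pi_def intro: order_trans\<close>)
  show ?thesis
    unfolding k by (rule degrees_le_sum[OF finite_exponents[OF assms(1)]], rule degrees_le_scale,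
        rule monom)
qed

lemma degrees_le_const: "finite I \<Longrightarrow> degrees_le I 0 (\<lambda>y. c)"
  using degrees_le_scale[OF degrees_le_monom[of I "\<lambda>_. 0" 0], of c] by simp

lemma poly_maps_degrees_le:
  assumes "finite I" "f \<in> poly_maps I"
  shows "\<exists>D. degrees_le I D f"
  using assms(2)
proof (induction rule: poly_maps.induct)
  case (poly_maps_const c)
  then show ?case using degrees_le_const[OF assms(1)] by blast
next
  case (poly_maps_var i)
  have "(\<Prod>j\<in>I. y j ^ of_bool (j = i)) = y i" for y :: "'a \<Rightarrow> 'b"
    using poly_maps_var assms(1) by (simp add: of_bool_def if_distrib cong: if_cong)
  moreover have "degrees_le I 1 (\<lambda>y :: 'a \<Rightarrow> 'b. \<Prod>j\<in>I. y j ^ of_bool (j = i))"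
    by (rule degrees_le_monom[OF assms(1)]) auto
  ultimately show ?case by (intro exI[of _ 1]) simp
next
  case (poly_maps_add f g)
  then obtain D E where "degrees_le I D f" "degrees_le I E g" by blast
  then have "degrees_le I (max D E) f" "degrees_le I (max D E) g"
    by (auto intro: degrees_le_mono[OF assms(1)])
  then show ?case using degrees_le_add by blast
next
  case (poly_maps_mult f g)
  then show ?case using degrees_le_mult[OF assms(1)] by blast
qed

lemma degrees_le_prod_powers:
  assumes "finite I" "\<And>i. i < m \<Longrightarrow> degrees_le I e (f i)" "\<And>i. i < m \<Longrightarrow> a i \<le> D"
  shows "degrees_le I (m * (D * e)) (\<lambda>y. \<Prod>i<m. f i y ^ a i)"
  using assms(2,3)
proof (induction m)
  case 0
  then show ?case using degrees_le_const[OF assms(1), of 1] by simp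
next
  case (Suc m)
  have fm: "degrees_le I e (f m)" by (rule Suc.prems) simp
  have "degrees_le I (j * e) (\<lambda>y. f m y ^ j)" for j
  proof (induction j)
    case 0
    then show ?case using degrees_le_const[OF assms(1), of 1] by simp
  next
    case (Suc j)
    then show ?case using degrees_le_mult[OF assms(1) fm Suc] by simp
  qed
  then have pow: "degrees_le I (D * e) (\<lambda>y. f m y ^ a m)"
    using degrees_le_mono[OF assms(1)] Suc.prems(2)[of m] by (meson lessI mult_le_mono1)
  have "degrees_le I (m * (D * e)) (\<lambda>y. \<Prod>i<m. f i y ^ a i)"
    by (rule Suc.IH) (use Suc.prems in auto)
  from degrees_le_mult[OF assms(1) this pow] show ?case
    by (simp add: add.commute)
qed

text \<open>
  For large \<open>D\<close> there are more products \<open>\<Prod> f\<^sub>i\<^bsup>a(i)\<^esup>\<close> with exponents below \<open>D\<close>, namely \<open>D\<^sup>m\<close>, than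
  monomials to expand them in, whose number grows only like \<open>D\<^bsup>card I\<^esup>\<close>.
\<close>

lemma exists_polynomial_relation:
  fixes f :: "nat \<Rightarrow> ('i \<Rightarrow> 'k::field) \<Rightarrow> 'k"
  assumes "finite I" "card I < m" "\<And>i. i < m \<Longrightarrow> f i \<in> poly_maps I"
  shows "\<exists>D c. (\<exists>a\<in>{..<m} \<rightarrow>\<^sub>E {..<D}. c a \<noteq> 0) \<and>
     (\<forall>y. (\<Sum>a\<in>{..<m} \<rightarrow>\<^sub>E {..<D}. c a * (\<Prod>i<m. f i y ^ a i)) = 0)"
proof -
  have "\<forall>i\<in>{..<m}. \<exists>D. degrees_le I D (f i)"
    using poly_maps_degrees_le[OF assms(1,3)] by blast
  then obtain e' where "\<forall>i\<in>{..<m}. degrees_le I (e' i) (f i)"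
    by (rule bchoice[THEN exE])
  then have e': "\<And>i. i < m \<Longrightarrow> degrees_le I (e' i) (f i)" by blast
  define e where "e = Max (e' ` {..<m})"
  have e: "degrees_le I e (f i)" if "i < m" for i
    using that by (intro degrees_le_mono[OF assms(1) e']) (auto simp: e_def)
  \<comment> \<open>The products have degree at most m D e in each variable, so there are at most
    \<open>(m D e + 1)\<^bsup>card I\<^esup> \<le> D\<^bsup>card I\<^esup> (m e + 1)\<^bsup>card I\<^esup>\<close> monomials; this D exceeds the last factor.\<close>
  define D where "D = (m * e + 1) ^ card I + 1"
  let ?A = "{..<m} \<rightarrow>\<^sub>E {..<D}" and ?M = "exponents I (m * (D * e))"
  have "degrees_le I (m * (D * e)) (\<lambda>y. \<Prod>i<m. f i y ^ a i)" if "a \<in> ?A" for a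
    by (rule degrees_le_prod_powers[OF assms(1) e])
        (use that in \<open>auto simp: PiE_def Pi_def intro: less_imp_le\<close>)
  then have "\<forall>a\<in>?A. \<exists>k. \<forall>y. (\<Prod>i<m. f i y ^ a i) = (\<Sum>\<mu>\<in>?M. k \<mu> * (\<Prod>i\<in>I. y i ^ \<mu> i))"
    unfolding degrees_le_def by blast
  then obtain k where "\<forall>a\<in>?A. \<forall>y. (\<Prod>i<m. f i y ^ a i) = (\<Sum>\<mu>\<in>?M. k a \<mu> * (\<Prod>i\<in>I. y i ^ \<mu> i))"
    by (rule bchoice[THEN exE])
  then have k: "\<And>a y. a \<in> ?A \<Longrightarrow> (\<Prod>i<m. f i y ^ a i) = (\<Sum>\<mu>\<in>?M. k a \<mu> * (\<Prod>i\<in>I. y i ^ \<mu> i))"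
    by blast
  have "card ?M = (m * (D * e) + 1) ^ card I"
    by (rule card_exponents[OF assms(1)])
  also have "\<dots> \<le> (D * (m * e + 1)) ^ card I"
    by (rule power_mono) (auto simp: D_def algebra_simps)
  also have "\<dots> < D ^ card I * D"
    unfolding power_mult_distrib by (intro mult_strict_left_mono) (auto simp: D_def)
  also have "\<dots> = D ^ Suc (card I)" by simp
  also have "\<dots> \<le> D ^ m"
    using assms(2) by (intro power_increasing) (auto simp: D_def)
  also have "\<dots> = card ?A" by (simp add: card_PiE)
  finally have "card ?M < card ?A" .
  then obtain c where c: "\<exists>a\<in>?A. c a \<noteq> 0" "\<forall>\<mu>\<in>?M. (\<Sum>a\<in>?A. c a * k a \<mu>) = 0"
    using homogeneous_system_nontrivial[of ?M ?A k] finite_exponents[OF assms(1)]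
        by (auto simp: finite_PiE)
  have "(\<Sum>a\<in>?A. c a * (\<Prod>i<m. f i y ^ a i)) = 0" for y
  proof -
    have "(\<Sum>a\<in>?A. c a * (\<Prod>i<m. f i y ^ a i)) = (\<Sum>a\<in>?A. \<Sum>\<mu>\<in>?M. c a * k a \<mu> * (\<Prod>i\<in>I. y i ^ \<mu> i))"
      by (rule sum.cong) (auto simp: k sum_distrib_left mult.assoc)
    also have "\<dots> = (\<Sum>\<mu>\<in>?M. \<Sum>a\<in>?A. c a * k a \<mu> * (\<Prod>i\<in>I. y i ^ \<mu> i))"
      by (rule sum.swap)
    also have "\<dots> = 0"
      by (rule sum.neutral) (use c(2) in \<open>simp flip: sum_distrib_right\<close>)
    finally show ?thesis .
  qed
  then show ?thesis using c(1) by blast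
qed

text \<open>
  Sort a relation among \<open>f\<^sub>0, \<dots>, f\<^sub>m\<close> by powers of \<open>f\<^sub>m\<close>. Since \<open>f\<^sub>m\<close> is not zero on the prime set
  \<open>Y\<^sub>m\<^sub>+\<^sub>1\<close>, the lowest power of \<open>f\<^sub>m\<close> can be cancelled there; restricting to \<open>Y\<^sub>m\<close>, where \<open>f\<^sub>m\<close>
  vanishes, leaves a relation among \<open>f\<^sub>0, \<dots>, f\<^sub>m\<^sub>-\<^sub>1\<close> formed by the coefficients of that power.
\<close>

lemma chain_algebraically_independent:
  fixes Y :: "nat \<Rightarrow> ('i \<Rightarrow> 'k::field) set"
  assumes f: "\<And>i. i < M \<Longrightarrow> f i \<in> poly_maps I"
    and ne: "Y 0 \<noteq> {}"
    and mono: "\<And>i. i < M \<Longrightarrow> Y i \<subseteq> Y (Suc i)"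
    and zero: "\<And>i y. i < M \<Longrightarrow> y \<in> Y i \<Longrightarrow> f i y = 0"
    and nz: "\<And>i. i < M \<Longrightarrow> \<exists>y\<in>Y (Suc i). f i y \<noteq> 0"
    and prime: "\<And>i g h. i \<le> M \<Longrightarrow> g \<in> poly_maps I \<Longrightarrow> h \<in> poly_maps I \<Longrightarrow> \<forall>y\<in>Y i. g y * h y = 0 \<Longrightarrow>
        (\<forall>y\<in>Y i. g y = 0) \<or> (\<forall>y\<in>Y i. h y = 0)"
    and "m \<le> M"
    and "\<forall>y\<in>Y m. (\<Sum>a\<in>{..<m} \<rightarrow>\<^sub>E {..<D}. c a * (\<Prod>i<m. f i y ^ a i)) = 0"
    and "a \<in> {..<m} \<rightarrow>\<^sub>E {..<D}"
  shows "c a = 0"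
  using assms(7-9)
proof (induction m arbitrary: c a)
  case 0
  then show ?case using ne by auto
next
  case (Suc m)
  have m: "m < M" using Suc.prems(1) by simp
  let ?A = "{..<m} \<rightarrow>\<^sub>E {..<D}"
  \<comment> \<open>The coefficient of the t-th power of f m, as a polynomial in the other functions.\<close>
  define h where "h t y = (\<Sum>a\<in>?A. c (a(m := t)) * (\<Prod>i<m. f i y ^ a i))" for t y
  have h_poly_maps: "h t \<in> poly_maps I" for t
    unfolding h_def using f m
    by (intro poly_maps_sum poly_maps_mult poly_maps_const poly_maps_prod poly_maps_power) (auto
        simp: finite_PiE)
  have split: "(\<Sum>a\<in>{..<Suc m} \<rightarrow>\<^sub>E {..<D}. c a * (\<Prod>i<Suc m. f i y ^ a i))
      = (\<Sum>t<D. f m y ^ t * h t y)" for y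
  proof -
    have "(\<Sum>t<D. f m y ^ t * h t y) = (\<Sum>t<D. \<Sum>a\<in>?A. c (a(m := t)) * ((\<Prod>i<m. f i y ^ a i) * f m y ^ t))"
      by (simp add: h_def sum_distrib_left mult_ac)
    also have "\<dots> = (\<Sum>(t, a)\<in>{..<D} \<times> ?A. c (a(m := t)) * ((\<Prod>i<m. f i y ^ a i) * f m y ^ t))"
      by (rule sum.cartesian_product)
    also have "\<dots> = (\<Sum>a\<in>{..<Suc m} \<rightarrow>\<^sub>E {..<D}. c a * (\<Prod>i<Suc m. f i y ^ a i))"
    proof (rule sum.reindex_bij_witness[where i = "\<lambda>a. (a m, a(m := undefined))" and j
        = "\<lambda>(t, a). a(m := t)"])
      fix z assume "z \<in> {..<D} \<times> ?A"
      then obtain t a where z: "z = (t, a)" "t < D" "a \<in> ?A" by auto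
      then have "a m = undefined" by (auto simp: PiE_def extensional_def)
      \<comment> \<open>Exponent vectors are undefined outside their domain, so this update restores the original one.\<close>
      then have "a(m := undefined) = a" by (rule fun_upd_idem)
      then show "((case z of (t, a) \<Rightarrow> a(m := t)) m, (case z of (t, a) \<Rightarrow> a(m := t))(m := undefined)) = z"
        by (simp add: z(1))
      show "(case z of (t, a) \<Rightarrow> a(m := t)) \<in> {..<Suc m} \<rightarrow>\<^sub>E {..<D}"
        using z(2,3) unfolding z(1) by (auto simp: PiE_def Pi_def extensional_def)
      show "c (case z of (t, a) \<Rightarrow> a(m := t)) * (\<Prod>i<Suc m. f i y ^ (case z of (t, a) \<Rightarrow> a(m := t)) i)
        = (case z of (t, a) \<Rightarrow> c (a(m := t)) * ((\<Prod>i<m. f i y ^ a i) * f m y ^ t))"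
        by (simp add: z(1))
    next
      fix a assume a: "a \<in> {..<Suc m} \<rightarrow>\<^sub>E {..<D}"
      then show "(a m, a(m := undefined)) \<in> {..<D} \<times> ?A"
        by (auto simp: PiE_def Pi_def extensional_def)
      show "(case (a m, a(m := undefined)) of (t, a) \<Rightarrow> a(m := t)) = a" by simp
    qed
    finally show ?thesis by simp
  qed
  have "\<forall>a\<in>?A. c (a(m := t)) = 0" if "t < D" for t
    using that
  proof (induction t rule: less_induct)
    case (less t)
    have h0: "h t' y = 0" if "t' < t" for t' y
    proof -
      have "c (a(m := t')) = 0" if "a \<in> ?A" for a
        using less.IH[OF \<open>t' < t\<close> less_trans[OF \<open>t' < t\<close> less.prems]] that by blast
      then show ?thesis unfolding h_def by (intro sum.neutral ballI) simp
    qed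
    define g where "g y = (\<Sum>t'\<in>{t<..<D}. f m y ^ (t' - t - 1) * h t' y)" for y
    have g_poly_maps: "g \<in> poly_maps I"
      unfolding g_def using f[OF m]
          by (intro poly_maps_sum poly_maps_mult poly_maps_power h_poly_maps) auto
    have fac: "(\<Sum>t'<D. f m y ^ t' * h t' y) = f m y ^ t * (h t y + f m y * g y)" for y
    proof -
      have dec: "{..<D} = {..<t} \<union> insert t {t<..<D}" using less.prems by auto
      have "(\<Sum>t'<D. f m y ^ t' * h t' y) = (\<Sum>t'\<in>{..<t}. f m y ^ t' * h t' y)
          + (\<Sum>t'\<in>insert t {t<..<D}. f m y ^ t' * h t' y)"
        unfolding dec by (rule sum.union_disjoint) auto
      also have "(\<Sum>t'\<in>{..<t}. f m y ^ t' * h t' y) = 0"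
        by (rule sum.neutral) (simp add: h0)
      also have "0 + (\<Sum>t'\<in>insert t {t<..<D}. f m y ^ t' * h t' y) = f m y ^ t * h t y
          + (\<Sum>t'\<in>{t<..<D}. f m y ^ t' * h t' y)"
        by simp
      also have "(\<Sum>t'\<in>{t<..<D}. f m y ^ t' * h t' y) = f m y ^ t * (f m y * g y)"
        unfolding g_def sum_distrib_left
      proof (rule sum.cong)
        fix t' assume "t' \<in> {t<..<D}"
        then have "t' = t + Suc (t' - t - 1)" by auto
        then have "f m y ^ t' = f m y ^ t * (f m y * f m y ^ (t' - t - 1))"
          by (metis power_add power_Suc)
        then show "f m y ^ t' * h t' y = f m y ^ t * (f m y * (f m y ^ (t' - t - 1) * h t' y))" by simp
      qed simp
      finally show ?thesis by (simp add: distrib_left)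
    qed
    have "\<forall>y\<in>Y (Suc m). f m y ^ t * (h t y + f m y * g y) = 0"
      using Suc.prems(2) unfolding split fac .
    then have "(\<forall>y\<in>Y (Suc m). f m y ^ t = 0) \<or> (\<forall>y\<in>Y (Suc m). h t y + f m y * g y = 0)"
      using Suc.prems(1) f[OF m] h_poly_maps g_poly_maps
      by (intro prime) (auto intro!: poly_maps_power poly_maps_add poly_maps_mult)
    moreover have "\<not> (\<forall>y\<in>Y (Suc m). f m y ^ t = 0)"
      using nz[OF m] by auto
    ultimately have sum0: "\<forall>y\<in>Y (Suc m). h t y + f m y * g y = 0" by blast
    have "h t y = 0" if "y \<in> Y m" for y
      using bspec[OF sum0 subsetD[OF mono[OF m] that]] zero[OF m that] by simp
    then have "\<forall>y\<in>Y m. (\<Sum>a\<in>?A. (\<lambda>a. c (a(m := t))) a * (\<Prod>i<m. f i y ^ a i)) = 0"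
      by (simp add: h_def)
    from Suc.IH[OF _ this] show ?case using m by simp
  qed
  moreover have "a m < D" "a(m := undefined) \<in> ?A"
    using Suc.prems(3) by (auto simp: PiE_def Pi_def extensional_def)
  ultimately have "c ((a(m := undefined))(m := a m)) = 0" by blast
  then show ?case by simp
qed

text \<open>
  The upper bound for the dimension of affine space, in terms of vanishing and primeness only.
  The function \<open>f i\<close> witnesses that \<open>Y i\<close> is strictly smaller than \<open>Y (Suc i)\<close>.
\<close>

lemma prime_chain_length_le:
  fixes Y :: "nat \<Rightarrow> ('i \<Rightarrow> 'k::field) set"
  assumes "finite I"
    and "\<And>i. i < m \<Longrightarrow> f i \<in> poly_maps I"
    and "Y 0 \<noteq> {}"
    and "\<And>i. i < m \<Longrightarrow> Y i \<subseteq> Y (Suc i)"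
    and "\<And>i y. i < m \<Longrightarrow> y \<in> Y i \<Longrightarrow> f i y = 0"
    and "\<And>i. i < m \<Longrightarrow> \<exists>y\<in>Y (Suc i). f i y \<noteq> 0"
    and "\<And>i g h. i \<le> m \<Longrightarrow> g \<in> poly_maps I \<Longrightarrow> h \<in> poly_maps I \<Longrightarrow> \<forall>y\<in>Y i. g y * h y = 0 \<Longrightarrow>
        (\<forall>y\<in>Y i. g y = 0) \<or> (\<forall>y\<in>Y i. h y = 0)"
  shows "m \<le> card I"
proof (rule ccontr)
  assume "\<not> m \<le> card I"
  then obtain D c a where rel: "a \<in> {..<m} \<rightarrow>\<^sub>E {..<D}" "c a \<noteq> 0"
     "\<forall>y. (\<Sum>a\<in>{..<m} \<rightarrow>\<^sub>E {..<D}. c a * (\<Prod>i<m. f i y ^ a i)) = 0"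
    using exists_polynomial_relation[of I m f] assms(1,2) by (auto simp: not_le)
  have rel': "\<forall>y\<in>Y m. (\<Sum>a\<in>{..<m} \<rightarrow>\<^sub>E {..<D}. c a * (\<Prod>i<m. f i y ^ a i)) = 0"
    using rel(3) by blast
  have "c a = 0"
  proof (rule chain_algebraically_independent[of m f I Y m c D a])
    show "m \<le> m" by simp
  qed (fact assms rel rel')+
  then show False using rel(2) by blast
qed

lemma poly_maps_line:
  assumes "f \<in> poly_maps I"
  shows "\<exists>p. \<forall>t. poly p t = f (\<lambda>i. y i + t * (z i - y i))"
  using assms
proof (induction rule: poly_maps.induct)
  case (poly_maps_const c)
  show ?case by (intro exI[of _ "[:c:]"]) simp
next
  case (poly_maps_var i)
  show ?case by (intro exI[of _ "[:y i, z i - y i:]"]) simp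
next
  case (poly_maps_add f g)
  then obtain p q where "\<forall>t. poly p t = f (\<lambda>i. y i + t * (z i - y i))" "\<forall>t. poly q t = g (\<lambda>i. y i
      + t * (z i - y i))" by blast
  then show ?case by (intro exI[of _ "p + q"]) simp
next
  case (poly_maps_mult f g)
  then obtain p q where "\<forall>t. poly p t = f (\<lambda>i. y i + t * (z i - y i))" "\<forall>t. poly q t = g (\<lambda>i. y i
      + t * (z i - y i))" by blast
  then show ?case by (intro exI[of _ "p * q"]) simp
qed

text \<open>
  On the line through \<open>y\<close> and \<open>z\<close> both functions become nonzero polynomials in one variable, and the
  field has more elements than their product has roots.
\<close>

lemma common_nonzero_on_lines:
  fixes f h :: "('i \<Rightarrow> 'k::field) \<Rightarrow> 'k"
  assumes "infinite (UNIV :: 'k set)" "f \<in> poly_maps I" "h \<in> poly_maps I"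
    and conv: "\<And>y z t. y \<in> Y \<Longrightarrow> z \<in> Y \<Longrightarrow> (\<lambda>i. y i + t * (z i - y i)) \<in> Y"
    and "y \<in> Y" "f y \<noteq> 0" "z \<in> Y" "h z \<noteq> 0"
  shows "\<exists>x\<in>Y. f x \<noteq> 0 \<and> h x \<noteq> 0"
proof -
  obtain p q where pq: "\<And>t. poly p t = f (\<lambda>i. y i + t * (z i - y i))"
      "\<And>t. poly q t = h (\<lambda>i. y i + t * (z i - y i))"
    using poly_maps_line[OF assms(2)] poly_maps_line[OF assms(3)] by metis
  have "poly p 0 \<noteq> 0" "poly q 1 \<noteq> 0" using assms(6,8) by (simp_all add: pq)
  then have "p * q \<noteq> 0" by auto
  then have "finite {t. poly (p * q) t = 0}" by (rule poly_roots_finite)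
  then obtain t where "poly (p * q) t \<noteq> 0" using assms(1)
      by (metis (mono_tags, lifting) UNIV_eq_I mem_Collect_eq)
  then show ?thesis using conv[OF assms(5,7), of t] pq by auto
qed

text \<open>
  Over a finite field the polynomial \<open>\<Prod>(X - a) + 1\<close> takes the value \<open>1\<close> everywhere, yet it is not
  constant.
\<close>

lemma infinite_UNIV_alg_closed: "infinite (UNIV :: 'k::alg_closed_field set)"
proof
  assume fin: "finite (UNIV :: 'k set)"
  define p where "p = (\<Prod>a\<in>UNIV. [:- a, 1 :: 'k:]) + 1"
  have p1: "poly p x = 1" for x
    using fin unfolding p_def by (simp add: poly_prod prod_zero_iff)
  have "degree (\<Prod>a\<in>UNIV. [:- a, 1 :: 'k:]) = card (UNIV :: 'k set)"
    by (subst degree_prod_eq_sum_degree) auto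
  moreover have "card (UNIV :: 'k set) > 0" using fin by (simp add: card_gt_0_iff)
  ultimately have "degree p > 0" unfolding p_def by (subst degree_add_eq_left) auto
  then obtain x where "poly p x = 0" using alg_closed_imp_poly_has_root by blast
  then show False using p1 by simp
qed

section \<open>Krull dimension of a space covered by affine cells\<close>

text \<open>
  A topological space covered by copies of affine space, described without regular functions on the
  space itself. By \<open>pullback\<close>, closed sets are cut out by polynomials in each chart; by
  \<open>hypersurface\<close>, the zero set of a polynomial in a chart, together with the complement of the
  chart, is closed.
\<close>

locale affine_atlas =
  fixes X :: "'a topology" and I :: "'i set" and \<Phi> :: "(('i \<Rightarrow> 'k::field) \<Rightarrow> 'a) set"
  assumes finite_I: "finite I"
    and infinite_field: "infinite (UNIV :: 'k set)"
    and nonempty: "\<Phi> \<noteq> {}"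
    and into: "\<phi> \<in> \<Phi> \<Longrightarrow> \<phi> y \<in> topspace X"
    and cover: "z \<in> topspace X \<Longrightarrow> \<exists>\<phi>\<in>\<Phi>. z \<in> range \<phi>"
    and hypersurface: "\<phi> \<in> \<Phi> \<Longrightarrow> f \<in> poly_maps I \<Longrightarrow>
          \<exists>C. closedin X C \<and> (\<forall>y. \<phi> y \<in> C \<longleftrightarrow> f y = 0) \<and> topspace X - C \<subseteq> range \<phi>"
    and pullback: "\<phi> \<in> \<Phi> \<Longrightarrow> closedin X Z \<Longrightarrow> \<phi> y0 \<notin> Z \<Longrightarrow>
          \<exists>f\<in>poly_maps I. f y0 \<noteq> 0 \<and> (\<forall>y. \<phi> y \<in> Z \<longrightarrow> f y = 0)"
begin

text \<open>
  If \<open>g h\<close> vanishes on the trace of \<open>Z\<close> in a chart, then the closed sets attached to \<open>g\<close> and \<open>h\<close>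
  cover \<open>Z\<close>, as they both contain everything outside the chart.
\<close>

lemma irreducible_trace_prime:
  assumes "\<phi> \<in> \<Phi>" "irreducible_closed X Z" "g \<in> poly_maps I" "h \<in> poly_maps I"
    and prod: "\<forall>y. \<phi> y \<in> Z \<longrightarrow> g y * h y = 0"
  shows "(\<forall>y. \<phi> y \<in> Z \<longrightarrow> g y = 0) \<or> (\<forall>y. \<phi> y \<in> Z \<longrightarrow> h y = 0)"
proof -
  obtain C where C: "closedin X C" "\<forall>y. \<phi> y \<in> C \<longleftrightarrow> g y = 0" "topspace X - C \<subseteq> range \<phi>"
    using hypersurface[OF assms(1,3)] by blast
  obtain D where D: "closedin X D" "\<forall>y. \<phi> y \<in> D \<longleftrightarrow> h y = 0" "topspace X - D \<subseteq> range \<phi>"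
    using hypersurface[OF assms(1,4)] by blast
  have Z: "closedin X Z" using assms(2) by (simp add: irreducible_closed_def)
  have "z \<in> C \<or> z \<in> D" if zZ: "z \<in> Z" for z
  proof (rule ccontr)
    assume no: "\<not> ?thesis"
    then obtain y where y: "z = \<phi> y" using C(3) closedin_subset[OF Z] zZ by blast
    then show False using no C(2) D(2) prod zZ by auto
  qed
  then have "Z = (Z \<inter> C) \<union> (Z \<inter> D)" by blast
  moreover have "closedin X (Z \<inter> C)" "closedin X (Z \<inter> D)" using Z C D by auto
  ultimately have "Z = Z \<inter> C \<or> Z = Z \<inter> D"
    using assms(2) unfolding irreducible_closed_def by blast
  then show ?thesis using C(2) D(2) by blast
qed

text \<open>
  All members of the chain meet a chart around a point of the smallest one, and their traces in this
  chart form a strictly increasing chain of prime sets.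
\<close>

lemma irreducible_chain_length_le:
  assumes irr: "\<forall>i\<le>m. irreducible_closed X (Z i)" and strict: "\<forall>i<m. Z i \<subset> Z (Suc i)"
  shows "m \<le> card I"
proof -
  have Z0: "Z 0 \<noteq> {}" "closedin X (Z 0)" using irr by (auto simp: irreducible_closed_def)
  then obtain z where z: "z \<in> Z 0" "z \<in> topspace X" using closedin_subset by fastforce
  obtain \<phi> y0 where \<phi>: "\<phi> \<in> \<Phi>" and y0: "z = \<phi> y0" using cover[OF z(2)] by blast
  define Y where "Y i = {y. \<phi> y \<in> Z i}" for i
  have sub0: "Z 0 \<subseteq> Z i" if "i \<le> m" for i
    using that
  proof (induction i)
    case (Suc i)
    then show ?case using strict by (meson Suc_le_eq less_imp_le psubset_imp_subset subset_trans)
  qed simp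
  have ex: "\<exists>f\<in>poly_maps I. (\<forall>y\<in>Y i. f y = 0) \<and> (\<exists>y\<in>Y (Suc i). f y \<noteq> 0)" if "i < m" for i
  proof -
    have irrS: "irreducible_closed X (Z i)" "irreducible_closed X (Z (Suc i))"
      using irr that by simp_all
    then have cl: "closedin X (Z i)" "closedin X (Z (Suc i))"
      unfolding irreducible_closed_def by blast+
    have "\<not> Y (Suc i) \<subseteq> Y i"
    proof
      assume sub: "Y (Suc i) \<subseteq> Y i"
      \<comment> \<open>The constant 1 has no zeros, so its closed set C is exactly the complement of the chart.\<close>
      obtain C where C: "closedin X C" "\<forall>y. \<phi> y \<notin> C" "topspace X - C \<subseteq> range \<phi>"
        using hypersurface[OF \<phi> poly_maps_const[of 1]] by auto
      have "Z (Suc i) \<subseteq> Z i \<union> C"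
      proof
        fix x assume x: "x \<in> Z (Suc i)"
        show "x \<in> Z i \<union> C"
        proof (cases "x \<in> C")
          case False
          then obtain y where "x = \<phi> y" using C(3) closedin_subset[OF cl(2)] x by blast
          then show ?thesis using sub x by (auto simp: Y_def)
        qed simp
      qed
      then have "Z (Suc i) = Z i \<union> (Z (Suc i) \<inter> C)" using strict that by blast
      then have "Z (Suc i) = Z i \<or> Z (Suc i) = Z (Suc i) \<inter> C"
        using irrS cl C(1) unfolding irreducible_closed_def by (meson closedin_Int)
      moreover have "Z (Suc i) \<noteq> Z i" using strict that by blast
      moreover have "\<phi> y0 \<in> Z (Suc i)" using sub0[of "Suc i"] that z(1) y0 by auto
      ultimately show False using C(2) by blast
    qed
    then obtain y where y: "y \<in> Y (Suc i)" "\<phi> y \<notin> Z i" by (auto simp: Y_def)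
    show ?thesis using pullback[OF \<phi> cl(1) y(2)] y(1) by (auto simp: Y_def)
  qed
  then have "\<forall>i\<in>{..<m}. \<exists>f. f \<in> poly_maps I \<and> (\<forall>y\<in>Y i. f y = 0) \<and> (\<exists>y\<in>Y (Suc i). f y \<noteq> 0)"
    by blast
  then obtain f where f: "\<forall>i\<in>{..<m}. f i \<in> poly_maps I \<and> (\<forall>y\<in>Y i. f i y = 0) \<and>
      (\<exists>y\<in>Y (Suc i). f i y \<noteq> 0)"
    by (rule bchoice[THEN exE])
  show ?thesis
  proof (rule prime_chain_length_le[of I m f Y])
    show "Y 0 \<noteq> {}" using z y0 by (auto simp: Y_def)
    show "Y i \<subseteq> Y (Suc i)" if "i < m" for i
      using strict that by (auto simp: Y_def)
    show "(\<forall>y\<in>Y i. g y = 0) \<or> (\<forall>y\<in>Y i. h y = 0)"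
      if "i \<le> m" "g \<in> poly_maps I" "h \<in> poly_maps I" "\<forall>y\<in>Y i. g y * h y = 0" for i g h
      using irreducible_trace_prime[OF \<phi> _ that(2,3), of "Z i"] irr that(1,4) by (auto simp: Y_def)
  qed (use f finite_I in auto)
qed

text \<open>
  The closures of the coordinate subspaces of one chart. They stay distinct because a coordinate
  function vanishing on one subspace vanishes on its closure but not on the next subspace.
\<close>

lemma irreducible_chain_exists:
  "\<exists>Z. (\<forall>i\<le>card I. irreducible_closed X (Z i)) \<and> (\<forall>i<card I. Z i \<subset> Z (Suc i))"
proof -
  obtain \<phi> where \<phi>: "\<phi> \<in> \<Phi>" using nonempty by blast
  obtain e where e: "bij_betw e {..<card I} I"
    using ex_bij_betw_nat_finite[OF finite_I] by (auto simp: lessThan_atLeast0)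
  define Y :: "nat \<Rightarrow> ('i \<Rightarrow> 'k) set" where "Y j = {y. \<forall>t. j \<le> t \<longrightarrow> t < card I \<longrightarrow> y (e t) = 0}" for j
  define Z where "Z j = X closure_of (\<phi> ` Y j)" for j
  have sub: "\<phi> ` Y j \<subseteq> Z j" for j
    unfolding Z_def by (rule closure_of_subset) (use into[OF \<phi>] in auto)
  have irr: "irreducible_closed X (Z j)" for j
    unfolding irreducible_closed_def
  proof (intro conjI allI impI)
    show "closedin X (Z j)" by (simp add: Z_def)
    have "(\<lambda>_. 0) \<in> Y j" by (simp add: Y_def)
    then show "Z j \<noteq> {}" using sub[of j] by blast
    fix C D assume CD: "closedin X C" "closedin X D" "Z j = C \<union> D"
    have "\<phi> ` Y j \<subseteq> C \<or> \<phi> ` Y j \<subseteq> D"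
    proof (rule ccontr)
      assume "\<not> ?thesis"
      then obtain y z where yz: "y \<in> Y j" "\<phi> y \<notin> C" "z \<in> Y j" "\<phi> z \<notin> D" by blast
      obtain f where f: "f \<in> poly_maps I" "f y \<noteq> 0" "\<forall>y. \<phi> y \<in> C \<longrightarrow> f y = 0"
        using pullback[OF \<phi> CD(1) yz(2)] by blast
      obtain h where h: "h \<in> poly_maps I" "h z \<noteq> 0" "\<forall>y. \<phi> y \<in> D \<longrightarrow> h y = 0"
        using pullback[OF \<phi> CD(2) yz(4)] by blast
      have conv: "(\<lambda>i. y i + t * (z i - y i)) \<in> Y j" if "y \<in> Y j" "z \<in> Y j" for y z t
        using that by (auto simp: Y_def)
      obtain x where "x \<in> Y j" "f x \<noteq> 0" "h x \<noteq> 0"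
        using common_nonzero_on_lines[OF infinite_field f(1) h(1) conv yz(1) f(2) yz(3) h(2)] by blast
      then show False using sub[of j] CD(3) f(3) h(3) by blast
    qed
    then show "Z j = C \<or> Z j = D"
    proof
      assume "\<phi> ` Y j \<subseteq> C"
      then have "Z j \<subseteq> C" unfolding Z_def by (rule closure_of_minimal[OF _ CD(1)])
      then show ?thesis using CD(3) by blast
    next
      assume "\<phi> ` Y j \<subseteq> D"
      then have "Z j \<subseteq> D" unfolding Z_def by (rule closure_of_minimal[OF _ CD(2)])
      then show ?thesis using CD(3) by blast
    qed
  qed
  have "Z j \<subset> Z (Suc j)" if j: "j < card I" for j
  proof -
    have ej: "e j \<in> I" using bij_betwE[OF e] j by blast
    obtain C where C: "closedin X C" "\<forall>y. \<phi> y \<in> C \<longleftrightarrow> y (e j) = 0"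
      using hypersurface[OF \<phi> poly_maps_var[OF ej]] by blast
    have "\<phi> ` Y j \<subseteq> C" using C(2) j by (auto simp: Y_def)
    then have "Z j \<subseteq> C" unfolding Z_def by (rule closure_of_minimal[OF _ C(1)])
    moreover define y :: "'i \<Rightarrow> 'k" where "y i = of_bool (i = e j)" for i
    have "e t \<noteq> e j" if "Suc j \<le> t" "t < card I" for t
      using inj_onD[OF bij_betw_imp_inj_on[OF e], of t j] that j by auto
    then have "y \<in> Y (Suc j)" by (auto simp: Y_def y_def)
    then have "\<phi> y \<in> Z (Suc j)" using sub by blast
    moreover have "\<phi> y \<notin> C" using C(2) by (simp add: y_def)
    moreover have "Z j \<subseteq> Z (Suc j)"
      unfolding Z_def by (rule closure_of_mono) (auto simp: Y_def)
    ultimately show ?thesis by blast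
  qed
  then show ?thesis using irr by (intro exI[of _ Z]) simp
qed

lemma krull_dim_eq_card: "krull_dim X = enat (card I)"
proof (rule antisym)
  show "krull_dim X \<le> enat (card I)"
    unfolding krull_dim_def by (rule Sup_least) (use irreducible_chain_length_le in fastforce)
  show "enat (card I) \<le> krull_dim X"
    unfolding krull_dim_def by (rule Sup_upper) (use irreducible_chain_exists in blast)
qed

end

section \<open>Polynomial functions on matrices and block triangular matrices\<close>

lemma index_mat_mult_sum:
  assumes "A \<in> carrier_mat m n" "B \<in> carrier_mat n k" "i < m" "j < k"
  shows "(A * B) $$ (i, j) = (\<Sum>l<n. A $$ (i, l) * B $$ (l, j))"
  using assms by (simp add: scalar_prod_def lessThan_atLeast0)

lemma poly_funs_sum: "finite S \<Longrightarrow> (\<And>a. a \<in> S \<Longrightarrow> f a \<in> poly_funs n) \<Longrightarrow> (\<lambda>A. \<Sum>a\<in>S. f a A) \<in> poly_funs n"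
  by (induction S rule: finite_induct) (auto intro: poly_funs.intros)

lemma poly_funs_prod: "finite S \<Longrightarrow> (\<And>a. a \<in> S \<Longrightarrow> f a \<in> poly_funs n) \<Longrightarrow> (\<lambda>A. \<Prod>a\<in>S. f a A) \<in> poly_funs n"
  by (induction S rule: finite_induct) (auto intro: poly_funs.intros)

lemma poly_funs_power: "f \<in> poly_funs n \<Longrightarrow> (\<lambda>A. f A ^ k) \<in> poly_funs n"
  by (induction k) (auto intro: poly_funs.intros)

lemma poly_funs_det:
  assumes "\<And>A. M A \<in> carrier_mat b b" "\<And>i j. i < b \<Longrightarrow> j < b \<Longrightarrow> (\<lambda>A. M A $$ (i, j)) \<in> poly_funs n"
  shows "(\<lambda>A. det (M A)) \<in> poly_funs n"
proof -
  have "(\<lambda>A. of_int (sign p) * (\<Prod>i = 0..<b. M A $$ (i, p i))) \<in> poly_funs n"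
    if p: "p permutes {0..<b}" for p
    using permutes_in_image[OF p] by (intro poly_funs.mult poly_funs.const poly_funs_prod assms(2)) auto
  then show ?thesis
    unfolding det_def'[OF assms(1)] by (intro poly_funs_sum) (auto simp: finite_permutations)
qed

text \<open>
  The equation holds only on square matrices of the right size, since elsewhere the matrix product
  involves a sum over a different range.
\<close>

lemma poly_funs_left_mult:
  assumes "f \<in> poly_funs n" "g \<in> carrier_mat n n"
  shows "\<exists>f'\<in>poly_funs n. \<forall>A\<in>carrier_mat n n. f' A = f (g * A)"
  using assms(1)
proof (induction rule: poly_funs.induct)
  case (const c)
  show ?case by (rule bexI[OF _ poly_funs.const[of c]]) simp
next
  case (coord i j)
  show ?case
  proof
    show "(\<lambda>A. \<Sum>l<n. g $$ (i, l) * A $$ (l, j)) \<in> poly_funs n"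
      using coord by (intro poly_funs_sum poly_funs.mult poly_funs.const poly_funs.coord) auto
    show "\<forall>A\<in>carrier_mat n n. (\<Sum>l<n. g $$ (i, l) * A $$ (l, j)) = (g * A) $$ (i, j)"
      using coord assms(2) by (simp add: index_mat_mult_sum del: index_mult_mat)
  qed
next
  case (add f h)
  then obtain f' h' where "f' \<in> poly_funs n" "\<forall>A\<in>carrier_mat n n. f' A = f (g * A)"
    "h' \<in> poly_funs n" "\<forall>A\<in>carrier_mat n n. h' A = h (g * A)" by blast
  then show ?case by (intro bexI[OF _ poly_funs.add[of f' n h']]) auto
next
  case (mult f h)
  then obtain f' h' where "f' \<in> poly_funs n" "\<forall>A\<in>carrier_mat n n. f' A = f (g * A)"
    "h' \<in> poly_funs n" "\<forall>A\<in>carrier_mat n n. h' A = h (g * A)" by blast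
  then show ?case by (intro bexI[OF _ poly_funs.mult[of f' n h']]) auto
qed

definition leading :: "nat \<Rightarrow> 'k::field mat \<Rightarrow> 'k mat" where
  "leading b A = mat b b (\<lambda>(i, j). A $$ (i, j))"

lemma leading_carrier [simp]: "leading b A \<in> carrier_mat b b"
  by (simp add: leading_def)

lemma index_leading [simp]: "i < b \<Longrightarrow> j < b \<Longrightarrow> leading b A $$ (i, j) = A $$ (i, j)"
  by (simp add: leading_def)

text \<open>
  Multiplication by a matrix that is block upper triangular at \<open>b\<close> combines the first \<open>b\<close> columns
  among themselves.
\<close>

lemma leading_mult:
  assumes "A \<in> carrier_mat n n" "p \<in> carrier_mat n n" "b \<le> n"
    and "\<And>l j. b \<le> l \<Longrightarrow> l < n \<Longrightarrow> j < b \<Longrightarrow> p $$ (l, j) = 0"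
  shows "leading b (A * p) = leading b A * leading b p"
proof (rule eq_matI)
  fix i j assume "i < dim_row (leading b A * leading b p)" "j < dim_col (leading b A * leading b p)"
  then have ij: "i < b" "j < b" by (auto simp: leading_def)
  have "leading b (A * p) $$ (i, j) = (\<Sum>l<n. A $$ (i, l) * p $$ (l, j))"
    using ij assms(3) index_mat_mult_sum[OF assms(1,2), of i j] by simp
  also have "\<dots> = (\<Sum>l<b. A $$ (i, l) * p $$ (l, j))"
    by (rule sum.mono_neutral_right) (use assms(3,4) ij in auto)
  also have "\<dots> = (leading b A * leading b p) $$ (i, j)"
    using ij index_mat_mult_sum[of "leading b A" b b "leading b p" b i j] by simp
  finally show "leading b (A * p) $$ (i, j) = (leading b A * leading b p) $$ (i, j)" .
qed (auto simp: leading_def)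

lemma det_lower_unitriangular:
  assumes "A \<in> carrier_mat b b" "\<And>i. i < b \<Longrightarrow> A $$ (i, i) = 1" "\<And>i j. i < j \<Longrightarrow> j < b \<Longrightarrow> A $$ (i, j) = 0"
  shows "det A = 1"
proof -
  have "det A = prod_list (diag_mat A)" by (rule det_lower_triangular) (use assms in auto)
  also have "\<dots> = (\<Prod>i = 0..<b. A $$ (i, i))" using assms(1) by (simp add: prod_list_diag_prod)
  also have "\<dots> = 1" by (rule prod.neutral) (use assms(2) in auto)
  finally show ?thesis .
qed

lemma det_leading_nonzero:
  fixes p :: "'k::field mat"
  assumes p: "p \<in> carrier_mat n n" and b: "b \<le> n" and nz: "det p \<noteq> 0"
    and zero: "\<And>l j. b \<le> l \<Longrightarrow> l < n \<Longrightarrow> j < b \<Longrightarrow> p $$ (l, j) = 0"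
  shows "det (leading b p) \<noteq> 0"
proof -
  obtain A1 A2 A3 A4 where s: "split_block p b b = (A1, A2, A3, A4)"
    by (metis prod_cases4)
  have dims: "dim_row p = b + (n - b)" "dim_col p = b + (n - b)" using p b by auto
  note parts = split_block[OF s dims]
  have A13: "A1 = leading b p" "A3 = 0\<^sub>m (n - b) b"
    using s p b zero by (auto simp: split_block_def Let_def leading_def intro!: eq_matI)
  have "det p = det A1 * det A4"
    by (subst parts(5)) (rule det_four_block_mat_lower_left_zero[OF parts(1,2) A13(2) parts(4)])
  then show ?thesis using nz A13(1) by auto
qed

lemma SL_inverse:
  assumes "g \<in> carrier (SL n)"
  shows "\<exists>g'\<in>carrier (SL n). g * g' = 1\<^sub>m n \<and> g' * g = 1\<^sub>m n"
proof
  have g: "g \<in> carrier_mat n n" "det g = 1" using assms by (auto simp: SL_def)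
  show *: "g * adj_mat g = 1\<^sub>m n \<and> adj_mat g * g = 1\<^sub>m n"
    using adj_mat[OF g(1)] g(2) by auto
  have "adj_mat g \<in> carrier_mat n n" by (rule adj_mat(1)[OF g(1)])
  moreover have "det (g * adj_mat g) = 1" using * by simp
  ultimately show "adj_mat g \<in> carrier (SL n)"
    using det_mult[OF g(1), of "adj_mat g"] g(2) by (simp add: SL_def)
qed

lemma SL_mult: "A \<in> carrier (SL n) \<Longrightarrow> B \<in> carrier (SL n) \<Longrightarrow> A * B \<in> carrier (SL n)"
  by (auto simp: SL_def det_mult)

lemma SL_carrier_mat: "A \<in> carrier (SL n) \<Longrightarrow> A \<in> carrier_mat n n"
  by (simp add: SL_def)

section \<open>The big cell of a partial flag variety\<close>

text \<open>
  A block decomposition of \<open>{0..<n}\<close> into consecutive intervals is encoded by the function \<open>\<beta>\<close>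
  that sends an index to the right end of its interval. Position \<open>(i, j)\<close> lies strictly below the
  diagonal blocks iff \<open>\<beta> j \<le> i\<close>.
\<close>

locale block_shape =
  fixes n :: nat and \<beta> :: "nat \<Rightarrow> nat"
  assumes beta_gt: "j < n \<Longrightarrow> j < \<beta> j" and beta_le: "j < n \<Longrightarrow> \<beta> j \<le> n"
    and beta_mono: "j < n \<Longrightarrow> i < \<beta> j \<Longrightarrow> \<beta> i \<le> \<beta> j"
begin

definition below :: "(nat \<times> nat) set" where
  "below = {(i, j). i < n \<and> j < n \<and> \<beta> j \<le> i}"

lemma finite_below: "finite below"
  by (rule finite_subset[of _ "{..<n} \<times> {..<n}"]) (auto simp: below_def)

definition parab :: "'k::field mat set" where
  "parab = {p \<in> carrier (SL n). \<forall>i j. i < n \<longrightarrow> j < n \<longrightarrow> \<beta> j \<le> i \<longrightarrow> p $$ (i, j) = 0}"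

text \<open>
  The block lower unitriangular matrix with prescribed entries; entries of \<open>y\<close> at positions other
  than \<open>below\<close> are ignored.
\<close>

definition unip :: "(nat \<times> nat \<Rightarrow> 'k::field) \<Rightarrow> 'k mat" where
  "unip y = mat n n (\<lambda>(i, j). if \<beta> j \<le> i then y (i, j) else of_bool (i = j))"

text \<open>
  With \<open>b = \<beta> j\<close>, the \<open>j\<close>-th column is the \<open>j\<close>-th column of the inverse of the leading \<open>b \<times> b\<close> block,
  extended by zero. So \<open>colops A\<close> is block upper triangular, and column \<open>j\<close> of \<open>A * colops A\<close> is the
  combination of the first \<open>b\<close> columns of \<open>A\<close> whose first \<open>b\<close> entries are those of a unit vector.
  This brings \<open>A\<close> to block lower unitriangular form in one step, with explicit entries.
\<close>

definition colops :: "'k::field mat \<Rightarrow> 'k mat" where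
  "colops A = mat n n (\<lambda>(l, j). if l < \<beta> j then adj_mat (leading (\<beta> j) A) $$ (l, j) / det (leading
      (\<beta> j) A) else 0)"

definition unip_coord :: "'k::field mat \<Rightarrow> nat \<times> nat \<Rightarrow> 'k" where
  "unip_coord A ij = (A * colops A) $$ ij"

definition minors_prod :: "'k::field mat \<Rightarrow> 'k" where
  "minors_prod A = (\<Prod>j<n. det (leading (\<beta> j) A))"

lemma minors_prod_nonzero_iff: "minors_prod A \<noteq> 0 \<longleftrightarrow> (\<forall>j<n. det (leading (\<beta> j) A) \<noteq> 0)"
  by (auto simp: minors_prod_def)

lemma parab_SL: "p \<in> parab \<Longrightarrow> p \<in> carrier (SL n)" by (simp add: parab_def)

lemma parab_zero: "p \<in> parab \<Longrightarrow> j < n \<Longrightarrow> \<beta> j \<le> l \<Longrightarrow> l < n \<Longrightarrow> j' < \<beta> j \<Longrightarrow> p $$ (l, j') = 0"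
  using beta_mono[of j j'] beta_le[of j] by (auto simp: parab_def)

lemma one_parab: "1\<^sub>m n \<in> parab"
  using beta_gt by (fastforce simp: parab_def SL_def)

lemma parab_mult:
  assumes "p \<in> parab" "p' \<in> parab"
  shows "p * p' \<in> parab"
proof -
  have c: "p \<in> carrier_mat n n" "p' \<in> carrier_mat n n" using assms
      by (auto dest: parab_SL SL_carrier_mat)
  have "(p * p') $$ (i, j) = 0" if ij: "i < n" "j < n" "\<beta> j \<le> i" for i j
  proof -
    have "(p * p') $$ (i, j) = (\<Sum>l<n. p $$ (i, l) * p' $$ (l, j))"
      by (rule index_mat_mult_sum[OF c ij(1,2)])
    also have "\<dots> = 0"
    proof (rule sum.neutral, rule ballI)
      fix l assume l: "l \<in> {..<n}"
      show "p $$ (i, l) * p' $$ (l, j) = 0"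
      proof (cases "l < \<beta> j")
        case True
        then show ?thesis using parab_zero[OF assms(1) ij(2,3,1), of l] by simp
      next
        case False
        then show ?thesis using assms(2) ij l by (auto simp: parab_def)
      qed
    qed
    finally show ?thesis .
  qed
  then show ?thesis using SL_mult[OF assms[THEN parab_SL]] by (simp add: parab_def)
qed

lemma det_leading_parab: "p \<in> parab \<Longrightarrow> j < n \<Longrightarrow> det (leading (\<beta> j) p) \<noteq> 0"
  using parab_zero[of p j] beta_le[of j]
      by (intro det_leading_nonzero[of p n]) (auto simp: parab_def SL_def)

lemma unip_SL: "unip y \<in> carrier (SL n)"
proof -
  have "unip y \<in> carrier_mat n n" by (simp add: unip_def)
  moreover have "det (unip y) = 1"
    by (rule det_lower_unitriangular[of _ n]) (use beta_gt in \<open>fastforce simp: unip_def\<close>)+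
  ultimately show ?thesis by (simp add: SL_def)
qed

lemma det_leading_unip:
  assumes "j < n"
  shows "det (leading (\<beta> j) (unip y)) = 1"
proof -
  have "leading (\<beta> j) (unip y) $$ (i, k) = (if \<beta> k \<le> i then y (i, k) else of_bool (i = k))"
    if "i < \<beta> j" "k < \<beta> j" for i k
    using that beta_le[OF assms] by (simp add: unip_def)
  moreover have "k < \<beta> k" if "k < \<beta> j" for k
    using that beta_le[OF assms] beta_gt[of k] by simp
  ultimately show ?thesis
    by (intro det_lower_unitriangular[of _ "\<beta> j"]) fastforce+
qed

lemma index_mult_colops:
  assumes A: "A \<in> carrier_mat n n" and ij: "i < n" "j < n"
  shows "(A * colops A) $$ (i, j) =
    (\<Sum>l<\<beta> j. A $$ (i, l) * adj_mat (leading (\<beta> j) A) $$ (l, j)) / det (leading (\<beta> j) A)"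
proof -
  have "(A * colops A) $$ (i, j) = (\<Sum>l<n. A $$ (i, l) * colops A $$ (l, j))"
    by (rule index_mat_mult_sum[OF A _ ij]) (simp add: colops_def)
  also have "\<dots> = (\<Sum>l<\<beta> j. A $$ (i, l) * colops A $$ (l, j))"
    by (rule sum.mono_neutral_right) (use beta_le[OF ij(2)] ij in \<open>auto simp: colops_def\<close>)
  also have "\<dots> = (\<Sum>l<\<beta> j. A $$ (i, l) * adj_mat (leading (\<beta> j) A) $$ (l, j) / det (leading (\<beta> j) A))"
    by (rule sum.cong) (use beta_le[OF ij(2)] ij in \<open>auto simp: colops_def\<close>)
  finally show ?thesis by (simp add: sum_divide_distrib)
qed

lemma mult_colops_upper:
  assumes A: "A \<in> carrier_mat n n" and nz: "minors_prod A \<noteq> 0" and ij: "j < n" "i < \<beta> j"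
  shows "(A * colops A) $$ (i, j) = of_bool (i = j)"
proof -
  let ?b = "\<beta> j"
  have b: "?b \<le> n" "j < ?b" using beta_le beta_gt ij by auto
  have "(\<Sum>l<?b. A $$ (i, l) * adj_mat (leading ?b A) $$ (l, j))
      = (leading ?b A * adj_mat (leading ?b A)) $$ (i, j)"
    using ij b index_mat_mult_sum[OF leading_carrier[of ?b A] adj_mat(1)[OF leading_carrier[of ?b
        A]] ij(2) b(2)] by simp
  also have "\<dots> = det (leading ?b A) * of_bool (i = j)"
    using adj_mat(2)[OF leading_carrier, of ?b A] ij b by simp
  finally show ?thesis
    using index_mult_colops[OF A, of i j] ij b nz by (simp add: minors_prod_nonzero_iff)
qed

text \<open>
  The entries below the diagonal blocks survive as free parameters; they are the coordinates of the
  coset of \<open>A\<close> in the big cell.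
\<close>

lemma mult_colops_eq_unip:
  assumes A: "A \<in> carrier_mat n n" and nz: "minors_prod A \<noteq> 0"
  shows "A * colops A = unip (unip_coord A)"
proof (rule eq_matI)
  fix i j assume "i < dim_row (unip (unip_coord A))" "j < dim_col (unip (unip_coord A))"
  then have "i < n" "j < n" by (auto simp: unip_def)
  then show "(A * colops A) $$ (i, j) = unip (unip_coord A) $$ (i, j)"
    using mult_colops_upper[OF assms, of j i] by (auto simp: unip_def unip_coord_def)
qed (use A in \<open>auto simp: unip_def colops_def\<close>)

lemma colops_parab:
  assumes A: "A \<in> carrier (SL n)" and nz: "minors_prod A \<noteq> 0"
  shows "colops A \<in> parab"
proof -
  have c: "colops A \<in> carrier_mat n n" by (simp add: colops_def)
  have A': "A \<in> carrier_mat n n" "det A = 1" using A by (auto simp: SL_def)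
  have "det A * det (colops A) = det (unip (unip_coord A))"
    unfolding mult_colops_eq_unip[OF A'(1) nz, symmetric] by (rule det_mult[OF A'(1) c, symmetric])
  then have "colops A \<in> carrier (SL n)" using A' unip_SL[of "unip_coord A"] c by (simp add: SL_def)
  then show ?thesis by (auto simp: parab_def colops_def)
qed

text \<open>
  The normal form \<open>p * colops p\<close> of an element of the parabolic is block upper triangular and block
  lower unitriangular, hence the identity. So \<open>colops p\<close>, which lies in the parabolic, is the inverse.
\<close>

lemma parab_inverse:
  assumes "p \<in> parab"
  shows "\<exists>p'\<in>parab. p * p' = 1\<^sub>m n \<and> p' * p = 1\<^sub>m n"
proof -
  have c: "p \<in> carrier_mat n n" "colops p \<in> carrier_mat n n"
    using assms by (auto simp: parab_def SL_def colops_def)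
  have nz: "minors_prod p \<noteq> 0" using det_leading_parab[OF assms] by (simp add: minors_prod_nonzero_iff)
  have "p * colops p = 1\<^sub>m n"
  proof (rule eq_matI)
    fix i j assume "i < dim_row (1\<^sub>m n)" "j < dim_col (1\<^sub>m n)"
    then have ij: "i < n" "j < n" by auto
    show "(p * colops p) $$ (i, j) = 1\<^sub>m n $$ (i, j)"
    proof (cases "i < \<beta> j")
      case True
      then show ?thesis using mult_colops_upper[OF c(1) nz ij(2)] ij by simp
    next
      case False
      then have "(\<Sum>l<\<beta> j. p $$ (i, l) * adj_mat (leading (\<beta> j) p) $$ (l, j)) = 0"
        using parab_zero[OF assms ij(2) _ ij(1)] by (intro sum.neutral) auto
      then show ?thesis using index_mult_colops[OF c(1) ij] ij beta_gt[OF ij(2)] False by auto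
    qed
  qed (use c in auto)
  moreover have "colops p * p = 1\<^sub>m n" by (rule mat_mult_left_right_inverse[OF c calculation])
  ultimately show ?thesis using colops_parab[OF parab_SL[OF assms] nz] by blast
qed

text \<open>
  Forward substitution in \<open>unip y' = unip y * p\<close>, column by column, shows \<open>p = 1\<close>.
\<close>

lemma unip_mult_parab_unique:
  assumes "unip y' = unip y * p" "p \<in> parab"
  shows "unip y' = unip y"
proof -
  have c: "unip y \<in> carrier_mat n n" "p \<in> carrier_mat n n" "unip y \<in> carrier_mat n n"
    using assms(2) by (auto simp: parab_def SL_def unip_def)
  have up: "p $$ (l, j) = of_bool (l = j)" if j: "j < n" and "l < \<beta> j" for l j
    using that(2)
  proof (induction l rule: less_induct)
    case (less l)
    have ln: "l < n" using less.prems beta_le[OF j] by simp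
    have "of_bool (l = j) = unip y' $$ (l, j)"
      using less.prems ln j by (simp add: unip_def)
    also have "\<dots> = (\<Sum>i<n. unip y $$ (l, i) * p $$ (i, j))"
      unfolding assms(1) by (rule index_mat_mult_sum[OF c(1,2) ln j])
    also have "\<dots> = unip y $$ (l, l) * p $$ (l, j) + (\<Sum>i\<in>{..<n} - {l}. unip y $$ (l, i) * p $$ (i, j))"
      using ln by (simp add: sum.remove[of "{..<n}" l])
    also have "(\<Sum>i\<in>{..<n} - {l}. unip y $$ (l, i) * p $$ (i, j)) = 0"
    proof (rule sum.neutral, rule ballI)
      fix i assume i: "i \<in> {..<n} - {l}"
      show "unip y $$ (l, i) * p $$ (i, j) = 0"
      proof (cases "i < l")
        case True
        then have "p $$ (i, j) = of_bool (i = j)" using less.IH[of i] less.prems by simp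
        moreover have "unip y $$ (l, j) = 0" if "i = j"
          using True that less.prems ln j by (simp add: unip_def)
        ultimately show ?thesis by auto
      next
        case False
        then show ?thesis using i ln beta_gt[of i] by (auto simp: unip_def)
      qed
    qed
    finally show ?case using beta_gt[OF ln] ln by (simp add: unip_def)
  qed
  have "p = 1\<^sub>m n"
  proof (rule eq_matI)
    fix i j assume "i < dim_row (1\<^sub>m n)" "j < dim_col (1\<^sub>m n)"
    then have ij: "i < n" "j < n" by auto
    show "p $$ (i, j) = 1\<^sub>m n $$ (i, j)"
    proof (cases "i < \<beta> j")
      case True
      then show ?thesis using up[OF ij(2)] ij by simp
    next
      case False
      then show ?thesis using parab_zero[OF assms(2) ij(2) _ ij(1), of j] beta_gt[OF ij(2)] ij by auto
    qed
  qed (use c in auto)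
  then show ?thesis using assms(1) c by simp
qed

lemma unip_eqD:
  assumes "unip y = unip z" "ij \<in> below"
  shows "y ij = z ij"
proof -
  obtain i j where ij: "ij = (i, j)" "i < n" "j < n" "\<beta> j \<le> i" using assms(2) by (auto simp: below_def)
  have "unip y $$ (i, j) = unip z $$ (i, j)" using assms(1) by simp
  then show ?thesis using ij by (simp add: unip_def)
qed

lemma minors_prod_mult_parab:
  assumes "A \<in> carrier_mat n n" "p \<in> parab"
  shows "minors_prod (A * p) \<noteq> 0 \<longleftrightarrow> minors_prod A \<noteq> 0"
proof -
  have "det (leading (\<beta> j) (A * p)) = det (leading (\<beta> j) A) * det (leading (\<beta> j) p)" if "j < n" for j
    using leading_mult[OF assms(1) _ beta_le[OF that]] parab_zero[OF assms(2) that] parab_SL[OF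
        assms(2)]
      det_mult[of "leading (\<beta> j) A" "\<beta> j" "leading (\<beta> j) p"]
    by (simp add: SL_def)
  then show ?thesis using det_leading_parab[OF assms(2)] by (simp add: minors_prod_nonzero_iff)
qed

text \<open>
  The coordinates depend only on the coset, because the normal forms of \<open>A\<close> and \<open>A p\<close> differ by an
  element of the parabolic.
\<close>

lemma unip_coord_mult_parab:
  assumes A: "A \<in> carrier (SL n)" and p: "p \<in> parab" and nz: "minors_prod A \<noteq> 0" and ij: "ij \<in> below"
  shows "unip_coord (A * p) ij = unip_coord A ij"
proof -
  have c: "A \<in> carrier_mat n n" "p \<in> carrier_mat n n" using A p by (auto simp: parab_def SL_def)
  have Ap: "A * p \<in> carrier (SL n)" using SL_mult[OF A parab_SL[OF p]] .
  have nz': "minors_prod (A * p) \<noteq> 0" using minors_prod_mult_parab[OF c(1) p] nz by simp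
  have q: "colops A \<in> parab" "colops (A * p) \<in> parab"
      using colops_parab[OF A nz] colops_parab[OF Ap nz'] by auto
  obtain r where r: "r \<in> parab" "colops A * r = 1\<^sub>m n" using parab_inverse[OF q(1)] by blast
  have qc: "colops A \<in> carrier_mat n n" "colops (A * p) \<in> carrier_mat n n" "r \<in> carrier_mat n n"
    using q r by (auto simp: parab_def SL_def)
  have "unip (unip_coord (A * p)) = (A * p) * colops (A * p)"
    using mult_colops_eq_unip[OF SL_carrier_mat[OF Ap] nz'] by simp
  also have "\<dots> = A * (colops A * r) * (p * colops (A * p))"
    using c qc r(2) by (simp add: assoc_mult_mat[of _ n n _ n _ n] mult_carrier_mat[of _ n n _ n])
  also have "\<dots> = (A * colops A) * (r * (p * colops (A * p)))"
    using c qc by (simp add: assoc_mult_mat[of _ n n _ n _ n] mult_carrier_mat[of _ n n _ n])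
  also have "\<dots> = unip (unip_coord A) * (r * (p * colops (A * p)))"
    using mult_colops_eq_unip[OF c(1) nz] by simp
  finally have "unip (unip_coord (A * p)) = unip (unip_coord A)"
    using unip_mult_parab_unique parab_mult q r p by blast
  then show ?thesis using unip_eqD ij by blast
qed

lemma minors_prod_unip: "minors_prod (unip y) \<noteq> 0"
  by (simp add: minors_prod_nonzero_iff det_leading_unip)

lemma unip_coord_unip:
  assumes "ij \<in> below"
  shows "unip_coord (unip y) ij = y ij"
proof -
  have "unip (unip_coord (unip y)) = unip y * colops (unip y)"
    by (rule mult_colops_eq_unip[OF SL_carrier_mat[OF unip_SL] minors_prod_unip, symmetric])
  then show ?thesis
    using unip_mult_parab_unique[OF _ colops_parab[OF unip_SL minors_prod_unip]] unip_eqD[OF _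
        assms] by blast
qed

lemma poly_funs_det_leading: "b \<le> n \<Longrightarrow> (\<lambda>A. det (leading b A)) \<in> poly_funs n"
  by (rule poly_funs_det[of _ b]) (auto intro: poly_funs.coord)

lemma poly_funs_adj_leading:
  assumes "b \<le> n" "l < b" "j < b"
  shows "(\<lambda>A. adj_mat (leading b A) $$ (l, j)) \<in> poly_funs n"
proof -
  have "(\<lambda>A. (-1) ^ (j + l) * det (mat_delete (leading b A) j l)) \<in> poly_funs n"
  proof (intro poly_funs.mult poly_funs.const poly_funs_det[of _ "b - 1"])
    show "mat_delete (leading b A) j l \<in> carrier_mat (b - 1) (b - 1)" for A
      by (simp add: mat_delete_def leading_def)
    show "(\<lambda>A. mat_delete (leading b A) j l $$ (i, k)) \<in> poly_funs n" if "i < b - 1" "k < b - 1" for i k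
      using that assms by (auto simp: mat_delete_def leading_def intro!: poly_funs.coord)
  qed
  also have "(\<lambda>A. (-1) ^ (j + l) * det (mat_delete (leading b A) j l))
      = (\<lambda>A. adj_mat (leading b A) $$ (l, j))"
    using assms by (simp add: adj_mat_def cofactor_def leading_def)
  finally show ?thesis .
qed

lemma poly_funs_minors_prod: "minors_prod \<in> poly_funs n"
  unfolding minors_prod_def[abs_def] by (intro poly_funs_prod poly_funs_det_leading beta_le) auto

text \<open>
  The coordinates of a coset are quotients by leading minors, so a polynomial in them becomes a
  polynomial in the matrix entries after multiplication by a power of the product of these minors.
\<close>

lemma clear_denominators:
  assumes "f \<in> poly_maps below"
  shows "\<exists>F\<in>poly_funs n. \<exists>K. \<forall>A\<in>carrier_mat n n. minors_prod A \<noteq> 0 \<longrightarrow>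
      F A = minors_prod A ^ K * f (unip_coord A)"
  using assms
proof (induction rule: poly_maps.induct)
  case (poly_maps_const c)
  show ?case by (rule bexI[OF _ poly_funs.const[of c]], rule exI[of _ 0]) simp
next
  case (poly_maps_var ij)
  then obtain i j where ij: "ij = (i, j)" "i < n" "j < n" by (auto simp: below_def)
  let ?F = "\<lambda>A. (\<Prod>j'\<in>{..<n} - {j}. det (leading (\<beta> j') A)) * (\<Sum>l<\<beta> j. A $$ (i, l) * adj_mat (leading
      (\<beta> j) A) $$ (l, j))"
  have "?F \<in> poly_funs n"
    using beta_le beta_gt ij
    by (intro poly_funs.mult poly_funs_prod poly_funs_sum poly_funs.coord poly_funs_adj_leading
        poly_funs_det_leading)
       (auto intro: less_le_trans)
  moreover have "?F A = minors_prod A ^ 1 * unip_coord A ij"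
      if "A \<in> carrier_mat n n" "minors_prod A \<noteq> 0" for A
  proof -
    have "minors_prod A = det (leading (\<beta> j) A) * (\<Prod>j'\<in>{..<n} - {j}. det (leading (\<beta> j') A))"
      using ij by (simp add: minors_prod_def prod.remove[of "{..<n}" j])
    then show ?thesis
      using that index_mult_colops[OF that(1) ij(2,3)] ij by (simp add: unip_coord_def)
  qed
  ultimately show ?case
    by (intro bexI[of _ "?F"] exI[of _ 1] ballI impI)
next
  case (poly_maps_add f g)
  then obtain F K G L where F: "F \<in> poly_funs n"
      "\<forall>A\<in>carrier_mat n n. minors_prod A \<noteq> 0 \<longrightarrow> F A = minors_prod A ^ K * f (unip_coord A)"
    and G: "G \<in> poly_funs n" "\<forall>A\<in>carrier_mat n n. minors_prod A \<noteq> 0 \<longrightarrow>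
        G A = minors_prod A ^ L * g (unip_coord A)"
    by blast
  have "(\<lambda>A. minors_prod A ^ L * F A + minors_prod A ^ K * G A) \<in> poly_funs n"
    by (intro poly_funs.add poly_funs.mult poly_funs_power poly_funs_minors_prod F G)
  moreover have "minors_prod A ^ L * F A + minors_prod A ^ K * G A = minors_prod A ^ (K
      + L) * (f (unip_coord A) + g (unip_coord A))"
    if "A \<in> carrier_mat n n" "minors_prod A \<noteq> 0" for A
    using F(2) G(2) that by (simp add: power_add algebra_simps)
  ultimately show ?case
    by (intro bexI[of _ "(\<lambda>A. minors_prod A ^ L * F A + minors_prod A ^ K * G A)"] exI[of _ "K
        + L"] ballI impI)
next
  case (poly_maps_mult f g)
  then obtain F K G L where F: "F \<in> poly_funs n"
      "\<forall>A\<in>carrier_mat n n. minors_prod A \<noteq> 0 \<longrightarrow> F A = minors_prod A ^ K * f (unip_coord A)"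
    and G: "G \<in> poly_funs n" "\<forall>A\<in>carrier_mat n n. minors_prod A \<noteq> 0 \<longrightarrow>
        G A = minors_prod A ^ L * g (unip_coord A)"
    by blast
  have "(\<lambda>A. F A * G A) \<in> poly_funs n" by (intro poly_funs.mult F G)
  moreover have "F A * G A = minors_prod A ^ (K + L) * (f (unip_coord A) * g (unip_coord A))"
    if "A \<in> carrier_mat n n" "minors_prod A \<noteq> 0" for A
    using F(2) G(2) that by (simp add: power_add algebra_simps)
  ultimately show ?case
    by (intro bexI[of _ "(\<lambda>A. F A * G A)"] exI[of _ "K + L"] ballI impI)
qed

lemma poly_maps_of_poly_funs:
  assumes "f \<in> poly_funs n" "g \<in> carrier_mat n n"
  shows "(\<lambda>y. f (g * unip y)) \<in> poly_maps below"
  using assms(1)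
proof (induction rule: poly_funs.induct)
  case (coord i j)
  have "(\<lambda>y. unip y $$ (l, j)) \<in> poly_maps below" if "l < n" for l
  proof (cases "\<beta> j \<le> l")
    case True
    then have "(l, j) \<in> below" using that coord by (simp add: below_def)
    from poly_maps_var[OF this] show ?thesis using True that coord by (simp add: unip_def)
  next
    case False
    then show ?thesis using that coord by (simp add: unip_def poly_maps_const)
  qed
  then have "(\<lambda>y. \<Sum>l<n. g $$ (i, l) * unip y $$ (l, j)) \<in> poly_maps below"
    by (intro poly_maps_sum poly_maps_mult poly_maps_const) auto
  moreover have "(g * unip y) $$ (i, j) = (\<Sum>l<n. g $$ (i, l) * unip y $$ (l, j))" for y
    by (rule index_mat_mult_sum[OF assms(2) _ coord]) (simp add: unip_def)
  ultimately show ?case by simp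
qed (auto intro: poly_maps.intros)

abbreviation coset :: "'k::field mat \<Rightarrow> 'k mat set" where
  "coset A \<equiv> A <#\<^bsub>SL n\<^esub> parab"

lemma coset_eq: "coset A = (\<lambda>p. A * p) ` parab"
  by (auto simp: l_coset_def SL_def)

lemma coset_mult_parab:
  assumes "A \<in> carrier_mat n n" "p \<in> parab"
  shows "coset (A * p) = coset A"
proof -
  have pc: "p \<in> carrier_mat n n" if "p \<in> parab" for p :: "'a mat" using that
      by (auto simp: parab_def SL_def)
  obtain p' where p': "p' \<in> parab" "p * p' = 1\<^sub>m n" using parab_inverse[OF assms(2)] by blast
  show ?thesis
    unfolding coset_eq
  proof (intro equalityI subsetI)
    fix x assume "x \<in> (\<lambda>r. A * p * r) ` parab"
    then obtain r where r: "r \<in> parab" "x = A * p * r" by blast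
    then have "x = A * (p * r)" using assms pc
        by (simp add: assoc_mult_mat[of _ n n _ n _ n] mult_carrier_mat[of _ n n _ n])
    then show "x \<in> (\<lambda>r. A * r) ` parab" using parab_mult[OF assms(2) r(1)] by blast
  next
    fix x assume "x \<in> (\<lambda>r. A * r) ` parab"
    then obtain r where r: "r \<in> parab" "x = A * r" by blast
    have "A * p * (p' * r) = A * ((p * p') * r)"
      using assms pc p'(1) r(1) by (simp add: assoc_mult_mat[of _ n n _ n _ n] mult_carrier_mat[of _
          n n _ n])
    then have "x = A * p * (p' * r)" using p'(2) r(2) left_mult_one_mat[OF pc[OF r(1)]] by simp
    then show "x \<in> (\<lambda>r. A * p * r) ` parab" using parab_mult[OF p'(1) r(1)] by blast
  qed
qed

lemma coset_eqD:
  assumes "A' \<in> carrier_mat n n" "coset A = coset A'"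
  shows "\<exists>p\<in>parab. A' = A * p"
proof -
  have "A' * 1\<^sub>m n \<in> coset A'" unfolding coset_eq using one_parab by blast
  then show ?thesis using assms unfolding coset_eq by auto
qed

abbreviation flag_space :: "'k::field mat set topology" where
  "flag_space \<equiv> coset_space n parab"

lemma topspace_zariski_SL:
    "topspace (subtopology (zariski n) (carrier (SL n))) = carrier (SL n :: 'k::field mat monoid)"
proof -
  have "zariski_open n (carrier_mat n n :: 'k mat set)"
    unfolding zariski_open_def
    by (intro exI[of _ "{\<lambda>A. 1}"]) (auto intro: poly_funs.const)
  then have "carrier_mat n n \<subseteq> topspace (zariski n :: 'k mat topology)"
    by (intro openin_subset) (simp add: openin_zariski)
  then show ?thesis by (auto simp: SL_def)
qed

lemma topspace_flag_space:
    "topspace (flag_space :: 'k::field mat set topology) = coset ` carrier (SL n)"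
proof
  show "topspace flag_space \<subseteq> coset ` carrier (SL n)"
    using openin_topspace[of flag_space] unfolding coset_space_def openin_quotient_space
        topspace_zariski_SL by blast
  have "{A \<in> carrier (SL n). coset A \<in> coset ` carrier (SL n)}
      = carrier (SL n :: 'k mat monoid)" by blast
  then have "openin flag_space (coset ` carrier (SL n) :: 'k mat set set)"
    unfolding coset_space_def openin_quotient_space topspace_zariski_SL
    using openin_topspace[of "subtopology (zariski n) (carrier (SL n :: 'k mat monoid))"]
    unfolding topspace_zariski_SL by simp
  then show "coset ` carrier (SL n) \<subseteq> topspace (flag_space :: 'k mat set topology)"
    by (rule openin_subset)
qed

lemma closedin_flag_space_iff:
  "closedin flag_space (Z :: 'k::field mat set set) \<longleftrightarrow> Z \<subseteq> coset ` carrier (SL n) \<and>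
     (\<exists>F\<subseteq>poly_funs n. \<forall>A\<in>carrier (SL n). coset A \<in> Z \<longleftrightarrow> (\<forall>f\<in>F. f A = 0))"
proof -
  let ?G = "carrier (SL n :: 'k mat monoid)"
  have "closedin flag_space Z \<longleftrightarrow> Z \<subseteq> coset ` ?G \<and>
      openin (subtopology (zariski n) ?G) {A \<in> ?G. coset A \<in> coset ` ?G - Z}"
    unfolding closedin_def topspace_flag_space
    unfolding coset_space_def openin_quotient_space topspace_zariski_SL by blast
  also have "{A \<in> ?G. coset A \<in> coset ` ?G - Z} = {A \<in> ?G. coset A \<notin> Z}" by blast
  also have "openin (subtopology (zariski n) ?G) {A \<in> ?G. coset A \<notin> Z} \<longleftrightarrow>
     (\<exists>F\<subseteq>poly_funs n. {A \<in> ?G. coset A \<notin> Z} = (carrier_mat n n - {A \<in> carrier_mat n n. \<forall>f\<in>F. f A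
         = 0}) \<inter> ?G)"
    unfolding openin_subtopology openin_zariski zariski_open_def by blast
  also have "\<dots> \<longleftrightarrow> (\<exists>F\<subseteq>poly_funs n. \<forall>A\<in>?G. coset A \<in> Z \<longleftrightarrow> (\<forall>f\<in>F. f A = 0))"
    using SL_carrier_mat by (intro arg_cong[where f = Ex] ext conj_cong refl) blast
  finally show ?thesis .
qed

definition chart :: "'k::field mat \<Rightarrow> (nat \<times> nat \<Rightarrow> 'k) \<Rightarrow> 'k mat set" where
  "chart g y = coset (g * unip y)"

text \<open>
  After clearing denominators and multiplying once more by the product of minors, one obtains a
  polynomial on \<open>SL\<^sub>n\<close> whose zero set is stable under the parabolic, agrees with the zero set of \<open>f\<close>
  on the cell and contains everything outside the cell.
\<close>

lemma chart_hypersurface: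
  fixes g :: "'k::field mat"
  assumes g: "g \<in> carrier (SL n)" and f: "f \<in> poly_maps below"
  shows "\<exists>C. closedin flag_space C \<and> (\<forall>y. chart g y \<in> C \<longleftrightarrow> f y = 0) \<and>
      topspace flag_space - C \<subseteq> range (chart g)"
proof -
  let ?G = "carrier (SL n :: 'k mat monoid)"
  obtain g' where g': "g' \<in> ?G" "g * g' = 1\<^sub>m n" "g' * g = 1\<^sub>m n" using SL_inverse[OF g] by blast
  note gc = SL_carrier_mat[OF g] SL_carrier_mat[OF g'(1)]
  obtain F K where F: "F \<in> poly_funs n"
      "\<forall>A\<in>carrier_mat n n. minors_prod A \<noteq> 0 \<longrightarrow> F A = minors_prod A ^ K * f (unip_coord A)"
    using clear_denominators[OF f] by blast
  obtain H where H: "H \<in> poly_funs n" "\<forall>A\<in>carrier_mat n n. H A = minors_prod (g' * A) * F (g' * A)"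
    using poly_funs_left_mult[OF poly_funs.mult[OF poly_funs_minors_prod F(1)] gc(2)] by blast
  have H0: "H A = 0 \<longleftrightarrow> minors_prod (g' * A) = 0 \<or> f (unip_coord (g' * A)) = 0"
      if "A \<in> carrier_mat n n" for A
    using H(2) F(2) that gc by auto
  have inv: "H (A * p) = 0 \<longleftrightarrow> H A = 0" if A: "A \<in> ?G" and p: "p \<in> parab" for A p
  proof -
    have c: "A \<in> carrier_mat n n" "p \<in> carrier_mat n n" using A p by (auto simp: parab_def SL_def)
    have B: "g' * A \<in> ?G" by (rule SL_mult[OF g'(1) A])
    have eq: "g' * (A * p) = (g' * A) * p" using c gc
        by (simp add: assoc_mult_mat[of _ n n _ n _ n] mult_carrier_mat[of _ n n _ n])
    have "f (unip_coord (g' * A * p)) = f (unip_coord (g' * A))" if "minors_prod (g' * A) \<noteq> 0"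
      by (rule poly_maps_cong[OF f]) (rule unip_coord_mult_parab[OF B p that])
    moreover have "A * p \<in> carrier_mat n n" using c by simp
    ultimately show ?thesis
      using H0 c minors_prod_mult_parab[OF SL_carrier_mat[OF B] p] unfolding eq by (metis eq)
  qed
  define C where "C = coset ` {A \<in> ?G. H A = 0}"
  have memC: "coset A \<in> C \<longleftrightarrow> H A = 0" if A: "A \<in> ?G" for A
  proof
    assume "coset A \<in> C"
    then obtain A' where A': "A' \<in> ?G" "H A' = 0" "coset A = coset A'" by (auto simp: C_def)
    obtain p where "p \<in> parab" "A' = A * p" using coset_eqD[OF SL_carrier_mat[OF A'(1)] A'(3)] by blast
    then show "H A = 0" using inv[OF A] A'(2) by simp
  qed (use A in \<open>auto simp: C_def\<close>)
  have "closedin flag_space C"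
    unfolding closedin_flag_space_iff
    by (intro conjI exI[of _ "{H}"]) (use H(1) memC in \<open>auto simp: C_def\<close>)
  moreover have "chart g y \<in> C \<longleftrightarrow> f y = 0" for y
  proof -
    have A: "g * unip y \<in> ?G" by (rule SL_mult[OF g unip_SL])
    have uc: "unip y \<in> carrier_mat n n" by (rule SL_carrier_mat[OF unip_SL])
    have eq: "g' * (g * unip y) = unip y"
      using assoc_mult_mat[OF gc(2,1) uc, symmetric] g'(3) uc by simp
    have "f (unip_coord (unip y)) = f y" by (rule poly_maps_cong[OF f unip_coord_unip])
    then show ?thesis
      unfolding chart_def memC[OF A]
          using H0[OF SL_carrier_mat[OF A]] minors_prod_unip[of y] unfolding eq by simp
  qed
  moreover have "z \<in> range (chart g)" if z: "z \<in> topspace flag_space" "z \<notin> C" for z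
  proof -
    obtain A where A: "A \<in> ?G" "z = coset A" using z(1) topspace_flag_space by blast
    note Ac = SL_carrier_mat[OF A(1)]
    let ?B = "g' * A"
    have B: "?B \<in> ?G" by (rule SL_mult[OF g'(1) A(1)])
    have nz: "minors_prod ?B \<noteq> 0" using memC[OF A(1)] z(2) A(2) H0[OF Ac] by auto
    have q: "colops ?B \<in> parab" by (rule colops_parab[OF B nz])
    then have qc: "colops ?B \<in> carrier_mat n n" by (auto simp: parab_def SL_def)
    have "g * unip (unip_coord ?B) = g * (?B * colops ?B)"
      using mult_colops_eq_unip[OF SL_carrier_mat[OF B] nz] by simp
    also have "\<dots> = (g * g') * A * colops ?B"
      using gc Ac qc by (simp add: assoc_mult_mat[of _ n n _ n _ n] mult_carrier_mat[of _ n n _ n])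
    also have "\<dots> = A * colops ?B" using g'(2) Ac by simp
    finally have "chart g (unip_coord ?B) = z"
      unfolding chart_def A(2) using coset_mult_parab[OF Ac q] by simp
    then show ?thesis by blast
  qed
  ultimately show ?thesis by blast
qed

lemma chart_pullback:
  fixes g :: "'k::field mat"
  assumes g: "g \<in> carrier (SL n)" and Z: "closedin flag_space Z" and y0: "chart g y0 \<notin> Z"
  shows "\<exists>f\<in>poly_maps below. f y0 \<noteq> 0 \<and> (\<forall>y. chart g y \<in> Z \<longrightarrow> f y = 0)"
proof -
  obtain F where F: "F \<subseteq> poly_funs n" "\<forall>A\<in>carrier (SL n). coset A \<in> Z \<longleftrightarrow> (\<forall>f\<in>F. f A = 0)"
    using Z unfolding closedin_flag_space_iff by blast
  have mem: "chart g y \<in> Z \<longleftrightarrow> (\<forall>f\<in>F. f (g * unip y) = 0)" for y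
    using F(2) SL_mult[OF g unip_SL[of y]] by (simp add: chart_def)
  then obtain f where f: "f \<in> F" "f (g * unip y0) \<noteq> 0" using y0 by blast
  have "(\<lambda>y. f (g * unip y)) \<in> poly_maps below"
    using f(1) F(1) by (intro poly_maps_of_poly_funs SL_carrier_mat[OF g]) blast
  moreover have "\<forall>y. chart g y \<in> Z \<longrightarrow> f (g * unip y) = 0" using f(1) mem by simp
  ultimately show ?thesis using f(2) by (intro bexI[of _ "\<lambda>y. f (g * unip y)"] conjI)
qed

text \<open>
  The atlas consists of all translates of the big cell; the coset of \<open>A\<close> is the origin of the cell
  translated by \<open>A\<close>.
\<close>

lemma krull_dim_flag_space:
  "krull_dim (flag_space :: 'k::alg_closed_field mat set topology) = enat (card below)"
proof -
  interpret affine_atlas "flag_space :: 'k mat set topology" below "chart ` carrier (SL n)"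
  proof
    show "chart ` carrier (SL n :: 'k mat monoid) \<noteq> {}" using unip_SL by blast
    show "\<phi> y \<in> topspace flag_space"
        if "\<phi> \<in> chart ` carrier (SL n)" for \<phi> :: "(nat \<times> nat \<Rightarrow> 'k) \<Rightarrow> 'k mat set" and y
      using that SL_mult[OF _ unip_SL[of y]] unfolding topspace_flag_space by (auto simp: chart_def)
    show "\<exists>\<phi>\<in>chart ` carrier (SL n). z \<in> range \<phi>" if z: "z \<in> topspace flag_space" for z :: "'k mat set"
    proof -
      obtain A where A: "A \<in> carrier (SL n)" "z = coset A" using z topspace_flag_space by blast
      have "unip (\<lambda>_. 0) = (1\<^sub>m n :: 'k mat)"
        by (rule eq_matI) (use beta_gt in \<open>fastforce simp: unip_def\<close>)+
      then have "chart A (\<lambda>_. 0) = z" using SL_carrier_mat[OF A(1)] A(2) by (simp add: chart_def)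
      then show ?thesis using A(1) by blast
    qed
  qed (use finite_below infinite_UNIV_alg_closed chart_hypersurface chart_pullback in auto)
  show ?thesis by (rule krull_dim_eq_card)
qed

end

section \<open>Affine permutation matrices and simple reflections\<close>

lemma mat_sum_carrier_index:
  fixes f :: "'i \<Rightarrow> 'b::comm_ring_1 mat"
  assumes "finite I" "\<And>i. i \<in> I \<Longrightarrow> f i \<in> carrier_mat n n"
  shows "mat_sum n f I \<in> carrier_mat n n \<and>
    (\<forall>a<n. \<forall>b<n. mat_sum n f I $$ (a, b) = (\<Sum>i\<in>I. f i $$ (a, b)))"
proof -
  interpret M: abelian_group "module_mat TYPE('b) n n" by (rule abelian_group_mat)
  show ?thesis
    using assms
  proof (induction I rule: finite_induct)
    case empty
    show ?case by (simp add: mat_sum_def module_mat_simps M.finsum_empty)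
  next
    case (insert x F)
    have "mat_sum n f (insert x F) = f x + mat_sum n f F"
      unfolding mat_sum_def using insert by (subst M.finsum_insert) (auto simp: module_mat_def)
    then show ?case using insert by auto
  qed
qed

text \<open>
  The matrix \<open>\<Sum>\<^sub>p t\<^bsup>b(p)\<^esup> E(p, \<tau> p)\<close>. It is indexed by rows rather than columns because left
  multiplication by a reflection, which is how words are built up, permutes rows, and because the
  exponents of \<open>\<kappa>\<close> are monotone in the row.
\<close>

definition monomial_mat :: "nat \<Rightarrow> (nat \<Rightarrow> int) \<Rightarrow> (nat \<Rightarrow> nat) \<Rightarrow> 'k::field fls mat" where
  "monomial_mat n b \<tau> = mat n n (\<lambda>(i, j). if j + 1 = \<tau> (i + 1) then fls_X_intpow (b (i + 1)) else 0)"

lemma monomial_mat_carrier [simp]: "monomial_mat n b \<tau> \<in> carrier_mat n n"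
  by (simp add: monomial_mat_def)

lemma monomial_mat_mult:
  assumes "\<tau> permutes {1..n}"
  shows "monomial_mat n b \<tau> * monomial_mat n b' \<tau>' = monomial_mat n (\<lambda>p. b p + b' (\<tau> p)) (\<tau>' \<circ> \<tau>)"
proof (rule eq_matI)
  fix i j assume "i < dim_row (monomial_mat n (\<lambda>p. b p + b' (\<tau> p)) (\<tau>' \<circ> \<tau>))"
    "j < dim_col (monomial_mat n (\<lambda>p. b p + b' (\<tau> p)) (\<tau>' \<circ> \<tau>))"
  then have ij: "i < n" "j < n" by (auto simp: monomial_mat_def)
  have t: "\<tau> (i+1) \<in> {1..n}" using permutes_in_image[OF assms, of "i+1"] ij by auto
  define u where "u = \<tau> (i+1) - 1"
  have u: "u < n" "\<tau> (i+1) = u + 1" using t by (auto simp: u_def)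
  have "(monomial_mat n b \<tau> * monomial_mat n b' \<tau>') $$ (i,j) =
    (\<Sum>k<n. monomial_mat n b \<tau> $$ (i,k) * monomial_mat n b' \<tau>' $$ (k,j))"
    using ij by (auto simp: monomial_mat_def scalar_prod_def lessThan_atLeast0)
  also have "\<dots> = (\<Sum>k<n. (if k = u then fls_X_intpow (b (i + 1)) * (if j + 1
      = \<tau>' (u+1) then fls_X_intpow (b' (u + 1)) else 0) else 0))"
    by (rule sum.cong) (use ij u in \<open>auto simp: monomial_mat_def\<close>)
  also have "\<dots> = monomial_mat n (\<lambda>p. b p + b' (\<tau> p)) (\<tau>' \<circ> \<tau>) $$ (i, j)"
    using ij u by (simp add: monomial_mat_def fls_X_intpow_times_fls_X_intpow)
  finally show "(monomial_mat n b \<tau> * monomial_mat n b' \<tau>') $$ (i,j) = monomial_mat n (\<lambda>p. b p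
      + b' (\<tau> p)) (\<tau>' \<circ> \<tau>) $$ (i, j)" .
qed (auto simp: monomial_mat_def)

lemma monomial_mat_cong:
  assumes "\<And>p. p \<in> {1..n} \<Longrightarrow> b p = b' p" "\<And>p. p \<in> {1..n} \<Longrightarrow> \<tau> p = \<tau>' p"
  shows "monomial_mat n b \<tau> = monomial_mat n b' \<tau>'"
  by (rule eq_matI) (use assms in \<open>auto simp: monomial_mat_def\<close>)

lemma monomial_mat_eqD:
  assumes "\<tau> permutes {1..n}" "\<tau>' permutes {1..n}"
    and eq: "monomial_mat n b \<tau> = (monomial_mat n b' \<tau>' :: 'k::field fls mat)" and p: "p \<in> {1..n}"
  shows "b p = b' p \<and> \<tau> p = \<tau>' p"
proof -
  have t: "\<tau> p \<in> {1..n}" using permutes_in_image[OF assms(1), of p] p by auto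
  have "(monomial_mat n b \<tau> :: 'k fls mat) $$ (p - 1, \<tau> p - 1) = fls_X_intpow (b p)"
    using p t by (auto simp: monomial_mat_def)
  moreover have "(monomial_mat n b' \<tau>' :: 'k fls mat) $$ (p - 1, \<tau> p - 1) =
      (if \<tau> p = \<tau>' p then fls_X_intpow (b' p) else 0)"
    using p t by (auto simp: monomial_mat_def)
  ultimately have "(fls_X_intpow (b p) :: 'k fls) = (if \<tau> p = \<tau>' p then fls_X_intpow (b' p) else 0)"
    using eq by simp
  then have "\<tau> p = \<tau>' p" "(fls_X_intpow (b p) :: 'k fls) = fls_X_intpow (b' p)"
    by (auto split: if_splits)
  then show ?thesis by (metis fls_subdegree_fls_X_intpow)
qed

lemma one_eq_monomial_mat: "1\<^sub>m n = monomial_mat n (\<lambda>_. 0) id"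
  by (rule eq_matI) (auto simp: monomial_mat_def)

lemma index_mat_sum:
  fixes f :: "'i \<Rightarrow> 'b::comm_ring_1 mat"
  assumes "finite I" "\<And>i. i \<in> I \<Longrightarrow> f i \<in> carrier_mat n n" "a < n" "b < n"
  shows "mat_sum n f I $$ (a, b) = (\<Sum>i\<in>I. f i $$ (a, b))"
  using mat_sum_carrier_index[of I f n] assms by auto

lemma dim_mat_sum:
  fixes f :: "'i \<Rightarrow> 'b::comm_ring_1 mat"
  assumes "finite I" "\<And>i. i \<in> I \<Longrightarrow> f i \<in> carrier_mat n n"
  shows "dim_row (mat_sum n f I) = n" "dim_col (mat_sum n f I) = n"
  using mat_sum_carrier_index[of I f n] assms by auto

lemma tE_carrier [simp]: "tE n c i j \<in> carrier_mat n n"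
  by (simp add: tE_def Emat_def)

lemma Emat_carrier [simp]: "Emat n i j \<in> carrier_mat n n"
  by (simp add: Emat_def)

lemma index_tE: "a < n \<Longrightarrow> b < n \<Longrightarrow>
    tE n c i j $$ (a, b) = (if a + 1 = i \<and> b + 1 = j then fls_X_intpow c else 0)"
  by (simp add: tE_def Emat_def)

lemma mat_sum_tE_cols:
  assumes "\<sigma> permutes {1..n}"
  shows "mat_sum n (\<lambda>i. tE n (c i) (\<sigma> i) i) {1..n}
      = monomial_mat n (c \<circ> inv_into UNIV \<sigma>) (inv_into UNIV \<sigma>)"
proof (rule eq_matI)
  fix i j assume "i < dim_row (monomial_mat n (c \<circ> inv_into UNIV \<sigma>) (inv_into UNIV \<sigma>))"
      "j < dim_col (monomial_mat n (c \<circ> inv_into UNIV \<sigma>) (inv_into UNIV \<sigma>))"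
  then have ij: "i < n" "j < n" by (auto simp: monomial_mat_def)
  have iff: "Suc i = \<sigma> (Suc j) \<longleftrightarrow> Suc j = inv_into UNIV \<sigma> (Suc i)"
    using permutes_inverses[OF assms] by metis
  have "mat_sum n (\<lambda>i. tE n (c i) (\<sigma> i) i) {1..n} $$ (i,j) =
     (\<Sum>k\<in>{1..n}. tE n (c k) (\<sigma> k) k $$ (i,j))"
    by (rule index_mat_sum) (use ij in auto)
  also have "\<dots> = (\<Sum>k\<in>{1..n}. if k = j + 1 then (if Suc i
      = \<sigma> (Suc j) then fls_X_intpow (c (j+1)) else 0) else 0)"
    by (rule sum.cong) (use ij in \<open>auto simp: index_tE\<close>)
  also have "\<dots> = monomial_mat n (c \<circ> inv_into UNIV \<sigma>) (inv_into UNIV \<sigma>) $$ (i,j)"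
    using ij iff by (auto simp: monomial_mat_def)
  finally show "mat_sum n (\<lambda>i. tE n (c i) (\<sigma> i) i) {1..n} $$ (i,j)
      = monomial_mat n (c \<circ> inv_into UNIV \<sigma>) (inv_into UNIV \<sigma>) $$ (i,j)" .
qed (auto simp: monomial_mat_def dim_mat_sum)

lemma carrier_affine_weyl:
  "carrier (affine_weyl n) = {monomial_mat n b \<tau> | b \<tau>. \<tau> permutes {1..n} \<and>
      sum b {1..n} = 0}" (is "?L = ?R")
proof
  show "?L \<subseteq> ?R"
  proof
    fix x assume "x \<in> ?L"
    then obtain c \<sigma> where x: "x = mat_sum n (\<lambda>i. tE n (c i) (\<sigma> i) i) {1..n}" and \<sigma>: "\<sigma> permutes {1..n}"
      and c: "sum c {1..n} = 0"
      by (auto simp: affine_weyl_def)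
    have "sum (c \<circ> inv_into UNIV \<sigma>) {1..n} = 0"
      using sum.permute[OF permutes_inv[OF \<sigma>], of c] c by simp
    then show "x \<in> ?R"
      using permutes_inv[OF \<sigma>] mat_sum_tE_cols[OF \<sigma>, of c] x by blast
  qed
  show "?R \<subseteq> ?L"
  proof
    fix x assume "x \<in> ?R"
    then obtain b \<tau> where x: "x = monomial_mat n b \<tau>" and \<tau>: "\<tau> permutes {1..n}" and b:
        "sum b {1..n} = 0"
      by auto
    define \<sigma> where "\<sigma> = inv_into UNIV \<tau>"
    have \<sigma>: "\<sigma> permutes {1..n}" "inv_into UNIV \<sigma> = \<tau>"
      using permutes_inv[OF \<tau>] permutes_inv_inv[OF \<tau>] by (auto simp: \<sigma>_def)
    have "x = mat_sum n (\<lambda>i. tE n ((b \<circ> \<sigma>) i) (\<sigma> i) i) {1..n}"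
      unfolding mat_sum_tE_cols[OF \<sigma>(1)] x \<sigma>(2)
      by (rule monomial_mat_cong) (auto simp: \<sigma>_def permutes_inverses[OF \<tau>])
    moreover have "sum (b \<circ> \<sigma>) {1..n} = 0"
      using sum.permute[OF \<sigma>(1), of b] b by simp
    ultimately show "x \<in> ?L" using \<sigma>(1) unfolding affine_weyl_def by auto
  qed
qed

text \<open>
  Exponents and row permutation of the simple reflection \<open>s\<^sub>a\<close>. The affine reflection \<open>s\<^sub>0\<close> exchanges
  the first and the last row with a shift.
\<close>

definition refl_shift :: "nat \<Rightarrow> nat \<Rightarrow> nat \<Rightarrow> int" where
  "refl_shift n a p = (if a = 0 then (if p = 1 then -1 else if p = n then 1 else 0) else 0)"

definition refl_perm :: "nat \<Rightarrow> nat \<Rightarrow> nat \<Rightarrow> nat" where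
  "refl_perm n a = (if a = 0 then Transposition.transpose 1 n else Transposition.transpose a (a + 1))"

lemma refl_perm_permutes: "a < n \<Longrightarrow> refl_perm n a permutes {1..n}"
  unfolding refl_perm_def by (auto intro!: permutes_swap_id)

lemma simple_refl_eq_monomial_mat:
  assumes "n \<ge> 2" "a < n"
  shows "simple_refl n a = (monomial_mat n (refl_shift n a) (refl_perm n a) :: 'k::field fls mat)"
proof (rule eq_matI)
  let ?A = "monomial_mat n (refl_shift n a) (refl_perm n a) :: 'k fls mat"
  fix i j assume "i < dim_row ?A" "j < dim_col ?A"
  then have ij: "i < n" "j < n" by (auto simp: monomial_mat_def)
  show "simple_refl n a $$ (i,j) = ?A $$ (i,j)"
  proof (cases "a = 0")
    case True
    have "mat_sum n (\<lambda>j. Emat n j j) {1<..<n} $$ (i, j)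
       = (\<Sum>k\<in>{1<..<n}. Emat n k k $$ (i, j) :: 'k fls)"
      by (rule index_mat_sum) (use ij in auto)
    also have "\<dots> = (\<Sum>k\<in>{1<..<n}. if k = j + 1 then (if i = j then 1 else 0) else (0::'k fls))"
      by (rule sum.cong) (use ij in \<open>auto simp: Emat_def\<close>)
    also have "\<dots> = (if i = j \<and> 1 < j + 1 \<and> j + 1 < n then 1 else 0)" by auto
    finally have m: "mat_sum n (\<lambda>j. Emat n j j) {1<..<n} $$ (i, j)
       = (if i = j \<and> 1 < j + 1 \<and> j + 1 < n then 1 else (0::'k fls))" .
    have "(simple_refl n a :: 'k fls mat) $$ (i,j) = tE n (-1) 1 n $$ (i,j) + tE n 1 n 1 $$ (i,j)
       + (mat_sum n (\<lambda>j. Emat n j j) {1<..<n} $$ (i, j) :: 'k fls)"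
      unfolding simple_refl_def using True ij by (simp add: dim_mat_sum tE_def Emat_def)
    then show ?thesis
      using ij assms True unfolding m
      by (auto simp: index_tE monomial_mat_def refl_shift_def refl_perm_def Transposition.transpose_def)
  next
    case False
    have "mat_sum n (\<lambda>j. Emat n (Transposition.transpose a (a + 1) j) j) {1..n} $$ (i, j)
       = (\<Sum>k\<in>{1..n}. Emat n (Transposition.transpose a (a + 1) k) k $$ (i, j) :: 'k fls)"
      by (rule index_mat_sum) (use ij in auto)
    also have "\<dots> = (\<Sum>k\<in>{1..n}. if k = j + 1 then (if i + 1 = Transposition.transpose a (a + 1) (j
        + 1) then 1 else 0) else (0::'k fls))"
      by (rule sum.cong) (use ij in \<open>auto simp: Emat_def\<close>)
    finally show ?thesis using False ij
      by (auto simp: simple_refl_def monomial_mat_def refl_shift_def refl_perm_def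
          Transposition.transpose_def split: if_splits)
  qed
qed (auto simp: simple_refl_def monomial_mat_def dim_mat_sum)

section \<open>The length of an affine permutation\<close>

definition pairs :: "nat \<Rightarrow> (nat \<times> nat) set" where
  "pairs n = {(p, q). 1 \<le> p \<and> p < q \<and> q \<le> n}"

lemma finite_pairs [simp]: "finite (pairs n)"
  by (rule finite_subset[of _ "{..n} \<times> {..n}"]) (auto simp: pairs_def)

text \<open>
  The number of affine inversions between the residue classes of two rows, up to sign.
\<close>

definition shi_term :: "(nat \<Rightarrow> int) \<Rightarrow> (nat \<Rightarrow> nat) \<Rightarrow> nat \<times> nat \<Rightarrow> int" where
  "shi_term b \<tau> = (\<lambda>(p, q). b p - b q + of_bool (\<tau> p > \<tau> q))"

definition affine_inversions :: "nat \<Rightarrow> (nat \<Rightarrow> int) \<Rightarrow> (nat \<Rightarrow> nat) \<Rightarrow> int" where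
  "affine_inversions n b \<tau> = (\<Sum>pq\<in>pairs n. \<bar>shi_term b \<tau> pq\<bar>)"

lemma affine_inversions_cong:
  assumes "\<And>p. p \<in> {1..n} \<Longrightarrow> b p = b' p" "\<And>p. p \<in> {1..n} \<Longrightarrow> \<tau> p = \<tau>' p"
  shows "affine_inversions n b \<tau> = affine_inversions n b' \<tau>'"
  unfolding affine_inversions_def by (rule sum.cong) (use assms in \<open>auto simp: pairs_def shi_term_def\<close>)

lemma affine_inversions_nonneg: "affine_inversions n b \<tau> \<ge> 0"
  unfolding affine_inversions_def by (rule sum_nonneg) auto

definition refl_exps :: "nat \<Rightarrow> nat \<Rightarrow> (nat \<Rightarrow> int) \<Rightarrow> nat \<Rightarrow> int" where
  "refl_exps n a b p = refl_shift n a p + b (refl_perm n a p)"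

definition refl_cols :: "nat \<Rightarrow> nat \<Rightarrow> (nat \<Rightarrow> nat) \<Rightarrow> nat \<Rightarrow> nat" where
  "refl_cols n a \<tau> = \<tau> \<circ> refl_perm n a"

lemma simple_refl_mult_monomial_mat:
  assumes "n \<ge> 2" "a < n"
  shows "simple_refl n a * monomial_mat n b \<tau>
      = (monomial_mat n (refl_exps n a b) (refl_cols n a \<tau>) :: 'k::field fls mat)"
  unfolding simple_refl_eq_monomial_mat[OF assms] monomial_mat_mult[OF refl_perm_permutes[OF assms(2)]]
    refl_exps_def[abs_def] refl_cols_def ..

lemma refl_twice:
  assumes "n \<ge> 2"
  shows "refl_exps n a (refl_exps n a b) = b" "refl_cols n a (refl_cols n a \<tau>) = \<tau>"
  using assms by (auto simp: refl_exps_def refl_cols_def refl_shift_def refl_perm_def fun_eq_iff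
      Transposition.transpose_def)

text \<open>
  Exchanging neighbouring rows permutes the summands of all pairs except the exchanged one, whose
  term \<open>x\<close> becomes \<open>1 - x\<close>.
\<close>

lemma affine_inversions_refl_finite:
  assumes "1 \<le> a" "a < n" "inj_on \<tau> {1..n}"
  shows "affine_inversions n (refl_exps n a b) (refl_cols n a \<tau>) =
     affine_inversions n b \<tau> - \<bar>shi_term b \<tau> (a, a+1)\<bar> + \<bar>1 - shi_term b \<tau> (a, a+1)\<bar>"
proof -
  let ?s = "Transposition.transpose a (a + 1)" and ?T = "pairs n - {(a, a+1)}"
  have mem: "(a, a+1) \<in> pairs n" using assms by (auto simp: pairs_def)
  have ne: "\<tau> a \<noteq> \<tau> (a + 1)" using inj_onD[OF assms(3), of a "a+1"] assms by auto
  have 1: "shi_term (refl_exps n a b) (refl_cols n a \<tau>) (a, a+1) = 1 - shi_term b \<tau> (a, a+1)"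
    using assms ne by (auto simp: shi_term_def refl_exps_def refl_cols_def refl_shift_def refl_perm_def)
  have mem': "(?s p, ?s q) \<in> ?T" if "(p, q) \<in> ?T" for p q
    using that assms by (auto simp: pairs_def Transposition.transpose_def)
  have 2: "(\<Sum>pq\<in>?T. \<bar>shi_term (refl_exps n a b) (refl_cols n a \<tau>) pq\<bar>) = (\<Sum>pq\<in>?T. \<bar>shi_term b \<tau> pq\<bar>)"
  proof (rule sum.reindex_bij_witness[where i = "\<lambda>(p,q). (?s p, ?s q)" and j = "\<lambda>(p,q). (?s p, ?s q)"])
    fix x assume "x \<in> ?T"
    then show "(case x of (p,q) \<Rightarrow> (?s p, ?s q)) \<in> ?T" using mem' by (cases x) auto
    show "\<bar>shi_term b \<tau> (case x of (p,q) \<Rightarrow> (?s p, ?s q))\<bar>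
        = \<bar>shi_term (refl_exps n a b) (refl_cols n a \<tau>) x\<bar>"
      using assms by (cases x) (simp add: shi_term_def refl_exps_def refl_cols_def refl_shift_def
          refl_perm_def)
  qed (use mem' in auto)
  show ?thesis
    unfolding affine_inversions_def sum.remove[OF finite_pairs mem] 1 2 by simp
qed

text \<open>
  The affine reflection turns the term of the pair \<open>(1, n)\<close> from \<open>x\<close> into \<open>-1 - x\<close>; the terms of
  \<open>(1, j)\<close> and \<open>(j, n)\<close> are exchanged and change sign.
\<close>

lemma affine_inversions_refl_affine:
  assumes "2 \<le> n" "inj_on \<tau> {1..n}"
  shows "affine_inversions n (refl_exps n 0 b) (refl_cols n 0 \<tau>) =
     affine_inversions n b \<tau> - \<bar>shi_term b \<tau> (1, n)\<bar> + \<bar>1 + shi_term b \<tau> (1, n)\<bar>"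
proof -
  let ?T = "pairs n - {(1, n)}"
  let ?f = "\<lambda>(p, q). if p = 1 then (q, n) else if q = n then (1, p) else (p, q)"
  have mem: "(1, n) \<in> pairs n" using assms by (auto simp: pairs_def)
  have ne: "\<tau> p \<noteq> \<tau> q" if "1 \<le> p" "p < q" "q \<le> n" for p q
    using inj_onD[OF assms(2), of p q] that by auto
  have 1: "shi_term (refl_exps n 0 b) (refl_cols n 0 \<tau>) (1, n) = - (1 + shi_term b \<tau> (1, n))"
    using assms ne[of 1 n] by (auto simp: shi_term_def refl_exps_def refl_cols_def refl_shift_def
        refl_perm_def)
  have 3: "\<bar>shi_term b \<tau> (?f pq)\<bar> = \<bar>shi_term (refl_exps n 0 b) (refl_cols n 0 \<tau>) pq\<bar>"
      if "pq \<in> ?T" for pq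
  proof -
    obtain p q where pq: "pq = (p, q)" "1 \<le> p" "p < q" "q \<le> n" "\<not> (p = 1 \<and> q = n)"
      using \<open>pq \<in> ?T\<close> by (auto simp: pairs_def)
    show ?thesis
      using pq ne[of 1 p] ne[of p n] ne[of 1 q] ne[of q n]
      by (auto simp: shi_term_def refl_exps_def refl_cols_def refl_shift_def refl_perm_def
          Transposition.transpose_def)
  qed
  have 2: "(\<Sum>pq\<in>?T. \<bar>shi_term (refl_exps n 0 b) (refl_cols n 0 \<tau>) pq\<bar>) = (\<Sum>pq\<in>?T. \<bar>shi_term b \<tau> pq\<bar>)"
  proof (rule sum.reindex_bij_witness[where i = ?f and j = ?f])
    fix x assume "x \<in> ?T"
    then show "?f (?f x) = x" "?f x \<in> ?T" "?f (?f x) = x" "?f x \<in> ?T"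
      by (cases x; simp add: pairs_def; linarith)+
  qed (rule 3)
  show ?thesis
    unfolding affine_inversions_def sum.remove[OF finite_pairs mem] 1 2 by simp
qed

text \<open>
  The condition that multiplication by \<open>s\<^sub>a\<close> shortens the element.
\<close>

definition descent :: "nat \<Rightarrow> (nat \<Rightarrow> int) \<Rightarrow> (nat \<Rightarrow> nat) \<Rightarrow> nat \<Rightarrow> bool" where
  "descent n b \<tau> a = (if a = 0 then shi_term b \<tau> (1, n) < 0 else shi_term b \<tau> (a, a + 1) > 0)"

lemma affine_inversions_refl:
  assumes "2 \<le> n" "a < n" "inj_on \<tau> {1..n}"
  shows "affine_inversions n (refl_exps n a b) (refl_cols n a \<tau>) =
     (if descent n b \<tau> a then affine_inversions n b \<tau> - 1 else affine_inversions n b \<tau> + 1)"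
proof (cases "a = 0")
  case True
  then show ?thesis using affine_inversions_refl_affine[OF assms(1,3), of b] by (auto simp: descent_def)
next
  case False
  then show ?thesis using affine_inversions_refl_finite[of a n \<tau> b] assms by (auto simp: descent_def)
qed

text \<open>
  Without descents the exponents increase weakly, and from the first row to the last by at most one.
  As they sum to zero they all vanish, and then \<open>\<tau>\<close> is increasing.
\<close>

lemma no_descent_imp_id:
  assumes "1 \<le> n" "\<tau> permutes {1..n}" "sum b {1..n} = 0"
    and nd: "\<And>a. a < n \<Longrightarrow> \<not> descent n b \<tau> a"
    and p: "p \<in> {1..n}"
  shows "b p = 0 \<and> \<tau> p = p"
proof -
  have step: "b a + of_bool (\<tau> a > \<tau> (a+1)) \<le> b (a+1)" if "1 \<le> a" "a < n" for a
    using nd[of a] that by (auto simp: descent_def shi_term_def)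
  have last: "b n \<le> b 1 + 1"
    using nd[of 0] assms(1) by (auto simp: descent_def shi_term_def of_bool_def split: if_splits)
  have mono: "b p \<le> b q" if "1 \<le> p" "p \<le> q" "q \<le> n" for p q
    using that(2,3)
  proof (induction q rule: dec_induct)
    case (step m)
    then show ?case using \<open>1 \<le> p\<close> \<open>\<And>a. \<lbrakk>1 \<le> a; a < n\<rbrakk> \<Longrightarrow> b a + of_bool (\<tau> a > \<tau> (a+1)) \<le> b (a+1)\<close>[of m]
      by (auto simp: of_bool_def split: if_splits)
  qed auto
  have b0: "b p = 0" if "p \<in> {1..n}" for p
  proof (rule ccontr)
    assume ne: "b p \<noteq> 0"
    \<comment> \<open>The exponents differ by at most one, so they are all nonnegative or all nonpositive; as their sum
      vanishes, so does each of them.\<close>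
    have bnd: "b 1 \<le> b q" "b q \<le> b 1 + 1" if "q \<in> {1..n}" for q
      using mono[of 1 q] mono[of q n] last that by auto
    show False
    proof (cases "b 1 \<ge> 0")
      case True
      have "sum b {1..n} > 0"
        by (rule sum_pos2[of _ p]) (use ne that True bnd in \<open>fastforce+\<close>)
      then show False using assms by simp
    next
      case False
      have "sum (\<lambda>q. - b q) {1..n} > 0"
        by (rule sum_pos2[of _ 1]) (use assms(1) False bnd in \<open>fastforce+\<close>)
      then show False using assms by (simp add: sum_negf)
    qed
  qed
  have inc: "\<tau> a < \<tau> (a+1)" if "1 \<le> a" "a < n" for a
  proof -
    have "\<not> \<tau> a > \<tau> (a+1)" using step[OF that] b0[of a] b0[of "a+1"] that by auto
    moreover have "\<tau> a \<noteq> \<tau> (a+1)" using inj_eq[OF permutes_inj[OF assms(2)], of a "a+1"] by simp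
    ultimately show ?thesis by simp
  qed
  have ge: "p \<le> \<tau> p" if "1 \<le> p" "p \<le> n" for p
    using that
  proof (induction p rule: dec_induct)
    case base
    then show ?case using permutes_in_image[OF assms(2), of 1] assms(1) by auto
  next
    case (step m)
    then show ?case using inc[of m] by auto
  qed
  have "sum \<tau> {1..n} = sum id {1..n}" using sum.permute[OF assms(2), of id] by simp
  then have "id p = \<tau> p"
    by (intro sum_mono_inv[of id "{1..n}" \<tau> p]) (use ge p in auto)
  then show ?thesis using b0[OF p] by simp
qed

abbreviation word_product :: "nat \<Rightarrow> 'k::field fls mat list \<Rightarrow> 'k fls mat" where
  "word_product n ws \<equiv> foldr (\<lambda>x y. x \<otimes>\<^bsub>affine_weyl n\<^esub> y) ws \<one>\<^bsub>affine_weyl n\<^esub>"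

lemma refl_cols_permutes: "a < n \<Longrightarrow> \<tau> permutes {1..n} \<Longrightarrow> refl_cols n a \<tau> permutes {1..n}"
  unfolding refl_cols_def by (intro permutes_compose refl_perm_permutes)

lemma sum_refl_exps:
  assumes "2 \<le> n" "a < n"
  shows "sum (refl_exps n a b) {1..n} = sum b {1..n}"
proof -
  have "sum (refl_shift n a) {1..n} = (\<Sum>p\<in>{1..n}. (if p = 1 then - of_bool (a = 0) else 0) + (if p
      = n then of_bool (a = 0) else 0))"
    by (rule sum.cong) (use assms in \<open>auto simp: refl_shift_def\<close>)
  also have "\<dots> = 0" using assms by (subst sum.distrib) auto
  finally show ?thesis
    using sum.permute[OF refl_perm_permutes[OF assms(2)], of b]
    by (simp add: refl_exps_def[abs_def] sum.distrib comp_def)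
qed

text \<open>
  Each letter of a word changes the number of affine inversions by one.
\<close>

lemma affine_inversions_word_le:
  assumes "set ws \<subseteq> (simple_refls n :: 'k::field fls mat set)"
  shows "\<exists>b \<tau>. word_product n ws = monomial_mat n b \<tau> \<and> \<tau> permutes {1..n} \<and>
      affine_inversions n b \<tau> \<le> int (length ws)"
  using assms
proof (induction ws)
  case Nil
  have "affine_inversions n (\<lambda>_. 0) id \<le> 0"
    unfolding affine_inversions_def by (rule sum_nonpos) (auto simp: pairs_def shi_term_def)
  then show ?case
    by (intro exI[of _ "\<lambda>_. 0 :: int"] exI[of _ "id :: nat \<Rightarrow> nat"])
      (simp add: affine_weyl_def one_eq_monomial_mat id_def permutes_id[unfolded id_def])
next
  case (Cons s ws)
  then obtain b \<tau> where IH: "word_product n ws = monomial_mat n b \<tau>" "\<tau> permutes {1..n}"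
      "affine_inversions n b \<tau> \<le> int (length ws)"
    by auto
  obtain a where a: "s = simple_refl n a" "a < n" "n \<ge> 2"
    using Cons.prems by (auto simp: simple_refls_def split: if_splits)
  have "word_product n (s # ws) = monomial_mat n (refl_exps n a b) (refl_cols n a \<tau>)"
    using IH(1) a simple_refl_mult_monomial_mat[OF a(3,2), of b \<tau>] by (simp add: affine_weyl_def)
  then show ?case
    using IH refl_cols_permutes[OF a(2) IH(2)] affine_inversions_refl[OF a(3,2) permutes_inj_on[OF
        IH(2)], of b]
    by (intro exI[of _ "refl_exps n a b"] exI[of _ "refl_cols n a \<tau>"]) auto
qed

text \<open>
  Descents are removed until none is left; reflections being involutions, the removed letters spell
  the element.
\<close>

lemma word_of_affine_inversions_length:
  assumes "1 \<le> n" "\<tau> permutes {1..n}" "sum b {1..n} = 0" "affine_inversions n b \<tau> = int k"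
  shows "\<exists>ws. length ws = k \<and> set ws \<subseteq> (simple_refls n :: 'k::field fls mat set) \<and>
      word_product n ws = monomial_mat n b \<tau>"
  using assms(2-)
proof (induction k arbitrary: b \<tau>)
  case 0
  have nd: "\<not> descent n b \<tau> a" if "a < n" for a
  proof
    assume d: "descent n b \<tau> a"
    then have "n \<ge> 2" using that by (cases "n = 1") (auto simp: descent_def shi_term_def)
    then have "affine_inversions n (refl_exps n a b) (refl_cols n a \<tau>) = -1"
      using affine_inversions_refl[OF _ that permutes_inj_on[OF 0(1)], of b] d 0 by simp
    then show False using affine_inversions_nonneg[of n "refl_exps n a b" "refl_cols n a \<tau>"] by simp
  qed
  have "monomial_mat n b \<tau> = (monomial_mat n (\<lambda>_. 0) id :: 'k fls mat)"
    by (rule monomial_mat_cong) (use no_descent_imp_id[OF assms(1) 0(1,2) nd] in auto)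
  then show ?case by (intro exI[of _ "[]"]) (simp add: affine_weyl_def one_eq_monomial_mat)
next
  case (Suc k)
  have "\<exists>a<n. descent n b \<tau> a"
  proof (rule ccontr)
    assume "\<not> ?thesis"
    then have nd: "\<And>a. a < n \<Longrightarrow> \<not> descent n b \<tau> a" by blast
    have "affine_inversions n b \<tau> = affine_inversions n (\<lambda>_. 0) id"
      by (rule affine_inversions_cong) (use no_descent_imp_id[OF assms(1) Suc.prems(1,2) nd] in auto)
    also have "\<dots> = 0"
      unfolding affine_inversions_def by (rule sum.neutral) (auto simp: pairs_def shi_term_def)
    finally show False using Suc.prems by simp
  qed
  then obtain a where a: "a < n" "descent n b \<tau> a" by blast
  then have n: "n \<ge> 2" by (cases "n = 1") (auto simp: descent_def shi_term_def)
  have "affine_inversions n (refl_exps n a b) (refl_cols n a \<tau>) = int k"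
    using affine_inversions_refl[OF n a(1) permutes_inj_on[OF Suc.prems(1)], of b] a Suc.prems by simp
  then obtain ws where ws: "length ws = k" "set ws \<subseteq> (simple_refls n :: 'k fls mat set)"
      "word_product n ws = monomial_mat n (refl_exps n a b) (refl_cols n a \<tau>)"
    using Suc.IH[of "refl_cols n a \<tau>"
        "refl_exps n a b"] refl_cols_permutes[OF a(1) Suc.prems(1)] sum_refl_exps[OF n a(1), of b]
        Suc.prems
    by auto
  have "word_product n (simple_refl n a # ws) = monomial_mat n b \<tau>"
    using simple_refl_mult_monomial_mat[OF n a(1), of "refl_exps n a b"
        "refl_cols n a \<tau>"] ws(3) refl_twice[OF n]
    by (simp add: affine_weyl_def)
  moreover have "simple_refl n a \<in> (simple_refls n :: 'k fls mat set)"
    using n a by (auto simp: simple_refls_def)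
  ultimately show ?case using ws by (intro exI[of _ "simple_refl n a # ws"]) auto
qed

lemma coxeter_length_monomial_mat:
  assumes "1 \<le> n" "\<tau> permutes {1..n}" "sum b {1..n} = 0"
  shows "int (coxeter_length n (monomial_mat n b \<tau> :: 'k::field fls mat)) = affine_inversions n b \<tau>"
proof -
  define k where "k = nat (affine_inversions n b \<tau>)"
  have k: "affine_inversions n b \<tau> = int k" using affine_inversions_nonneg[of n b \<tau>]
      by (simp add: k_def)
  have "coxeter_length n (monomial_mat n b \<tau> :: 'k fls mat) = k"
    unfolding coxeter_length_def word_length_def
  proof (rule Least_equality)
    show "\<exists>ws. length ws = k \<and> set ws \<subseteq> (simple_refls n :: 'k fls mat set) \<and>
        word_product n ws = monomial_mat n b \<tau>"
      by (rule word_of_affine_inversions_length[OF assms k])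
  next
    fix j assume "\<exists>ws. length ws = j \<and> set ws \<subseteq> (simple_refls n :: 'k fls mat set) \<and>
        word_product n ws = monomial_mat n b \<tau>"
    then obtain ws where ws: "length ws = j" "set ws \<subseteq> (simple_refls n :: 'k fls mat set)"
        "word_product n ws = monomial_mat n b \<tau>"
      by blast
    obtain b' \<tau>' where *: "word_product n ws = monomial_mat n b' \<tau>'" "\<tau>' permutes {1..n}"
        "affine_inversions n b' \<tau>' \<le> int (length ws)"
      using affine_inversions_word_le[OF ws(2)] by blast
    have "affine_inversions n b \<tau> = affine_inversions n b' \<tau>'"
      by (rule affine_inversions_cong)
          (use monomial_mat_eqD[OF assms(2) *(2) ws(3)[symmetric, unfolded *(1)]] in auto)
    then show "k \<le> j" using k * ws by simp
  qed
  then show ?thesis using k by simp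
qed

section \<open>Sums over pairs and inversions of words\<close>

lemma sum_odd_numbers: "(\<Sum>j\<in>{1..m}. 2 * int j - 1) = int m ^ 2"
  by (induction m) (auto simp: power2_eq_square algebra_simps)

lemma square_of_sum:
  fixes f :: "nat \<Rightarrow> int"
  shows "(\<Sum>k\<in>{1..m}. f k)^2 = (\<Sum>k\<in>{1..m}. f k ^ 2) + 2 * (\<Sum>k\<in>{1..m}. \<Sum>k'\<in>{1..<k}. f k * f k')"
proof (induction m)
  case (Suc m)
  have "(\<Sum>k'\<in>{1..<Suc m}. f (Suc m) * f k') = f (Suc m) * (\<Sum>k\<in>{1..m}. f k)"
    by (simp add: sum_distrib_left atLeastLessThanSuc_atLeastAtMost)
  then show ?case using Suc by (simp add: power2_eq_square algebra_simps)
qed simp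

lemma sum_pairs:
  fixes f :: "nat \<Rightarrow> nat \<Rightarrow> int"
  shows "(\<Sum>(p, q)\<in>pairs m. f p q) = (\<Sum>p\<in>{1..m}. \<Sum>q\<in>{p<..m}. f p q)"
    "(\<Sum>(p, q)\<in>pairs m. f p q) = (\<Sum>q\<in>{1..m}. \<Sum>p\<in>{1..<q}. f p q)"
proof -
  show "(\<Sum>(p, q)\<in>pairs m. f p q) = (\<Sum>p\<in>{1..m}. \<Sum>q\<in>{p<..m}. f p q)"
    unfolding sum.Sigma[OF finite_atLeastAtMost ballI[OF finite_greaterThanAtMost]]
    by (rule sum.cong) (auto simp: pairs_def)
  have "(\<Sum>q\<in>{1..m}. \<Sum>p\<in>{1..<q}. f p q) = (\<Sum>(q, p)\<in>(SIGMA q:{1..m}. {1..<q}). f p q)"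
    by (rule sum.Sigma) auto
  also have "\<dots> = (\<Sum>(p, q)\<in>pairs m. f p q)"
    by (rule sum.reindex_bij_witness[where i = prod.swap and j = prod.swap]) (auto simp: pairs_def)
  finally show "(\<Sum>(p, q)\<in>pairs m. f p q) = (\<Sum>q\<in>{1..m}. \<Sum>p\<in>{1..<q}. f p q)" by simp
qed

text \<open>
  In the sum over all pairs, \<open>f p\<close> occurs \<open>m - p\<close> times as first and \<open>p - 1\<close> times as second entry.
\<close>

lemma sum_pairs_diff:
  fixes f :: "nat \<Rightarrow> int"
  shows "(\<Sum>(p, q)\<in>pairs m. f p - f q) = (\<Sum>p\<in>{1..m}. f p * (int m + 1 - 2 * int p))"
proof -
  have "(\<Sum>(p, q)\<in>pairs m. f p - f q) = (\<Sum>(p, q)\<in>pairs m. f p) - (\<Sum>(p, q)\<in>pairs m. f q)"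
    by (simp add: sum_subtractf case_prod_unfold)
  also have "\<dots> = (\<Sum>p\<in>{1..m}. (int m - int p) * f p) - (\<Sum>p\<in>{1..m}. (int p - 1) * f p)"
    unfolding sum_pairs(1)[of "\<lambda>p q. f p"] sum_pairs(2)[of "\<lambda>p q. f q"]
    by (simp add: of_nat_diff)
  finally show ?thesis by (simp add: sum_subtractf[symmetric] algebra_simps)
qed

fun list_inversions :: "nat list \<Rightarrow> nat" where
  "list_inversions [] = 0"
| "list_inversions (x # xs) = length (filter (\<lambda>y. y < x) xs) + list_inversions xs"

lemma list_inversions_append:
    "list_inversions (xs @ ys) = list_inversions xs + list_inversions ys
    + (\<Sum>x\<leftarrow>xs. length (filter (\<lambda>y. y < x) ys))"
  by (induction xs) auto

lemma list_inversions_sorted: "sorted xs \<Longrightarrow> list_inversions xs = 0"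
  by (induction xs) (auto simp: filter_empty_conv)

lemma sum_pairs_list_inversions:
  "(\<Sum>(p, q)\<in>pairs (length xs). of_bool (xs ! (p - 1) > xs ! (q - 1))) = int (list_inversions xs)"
proof (induction xs)
  case Nil
  have "pairs 0 = {}" by (auto simp: pairs_def)
  then show ?case by simp
next
  case (Cons x xs)
  let ?g = "\<lambda>(p, q). of_bool ((x # xs) ! (p - 1) > (x # xs) ! (q - 1)) :: int"
  let ?A = "(\<lambda>q. (1, q + 2)) ` {..<length xs}" and ?B = "(\<lambda>(p, q). (p + 1, q + 1)) ` pairs (length xs)"
  have "pairs (length (x # xs)) = ?A \<union> ?B"
  proof (intro equalityI subsetI)
    fix z assume "z \<in> pairs (length (x # xs))"
    then obtain p q where z: "z = (p, q)" "1 \<le> p" "p < q" "q \<le> Suc (length xs)"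
        by (auto simp: pairs_def)
    show "z \<in> ?A \<union> ?B"
    proof (cases "p = 1")
      case True
      then have "z = (\<lambda>q. (1, q + 2)) (q - 2)" "q - 2 < length xs" using z by auto
      then show ?thesis by blast
    next
      case False
      then have "z = (\<lambda>(p, q). (p + 1, q + 1)) (p - 1, q - 1)" "(p - 1, q - 1) \<in> pairs (length xs)"
        using z by (auto simp: pairs_def)
      then show ?thesis by blast
    qed
  qed (auto simp: pairs_def)
  moreover have "?A \<inter> ?B = {}" by (auto simp: pairs_def)
  ultimately have "sum ?g (pairs (length (x # xs))) = sum ?g ?A + sum ?g ?B"
    by (simp add: sum.union_disjoint)
  moreover have "sum ?g ?A = int (length (filter (\<lambda>y. y < x) xs))"
    by (subst sum.reindex) (auto simp: inj_on_def length_filter_conv_card Int_def)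
  moreover have "sum ?g ?B = (\<Sum>(p, q)\<in>pairs (length xs). of_bool (xs ! (p - 1) > xs ! (q - 1)))"
    by (subst sum.reindex) (auto simp: inj_on_def pairs_def nth_Cons' intro!: sum.cong)
  ultimately show ?case using Cons by simp
qed

section \<open>The reading word of the tableau and the element \<open>\<kappa>\<close>\<close>

locale composition =
  fixes n r :: nat and d :: "nat \<Rightarrow> nat"
  assumes r_pos: "0 < r" and d_0: "d 0 = 0" and d_strict: "strict_mono_on {0..r} d" and d_r: "d r = n"
begin

lemma d_mono: "i \<le> j \<Longrightarrow> j \<le> r \<Longrightarrow> d i \<le> d j"
  using strict_mono_on_leD[OF d_strict, of i j] by simp

lemma d_less: "i < j \<Longrightarrow> j \<le> r \<Longrightarrow> d i < d j"
  using strict_mono_onD[OF d_strict, of i j] by simp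

lemma n_pos: "1 \<le> n"
  using d_less[of 0 r] r_pos d_0 d_r by simp

lemma Row_less:
  assumes "x \<in> Row d k'" "y \<in> Row d k" "k' < k" "k \<le> r"
  shows "x < y"
proof -
  have "d k' \<le> d (k - 1)" by (rule d_mono) (use assms in auto)
  then show ?thesis using assms by (auto simp: Row_def)
qed

lemma Row_UN: "i \<le> r \<Longrightarrow> (\<Union>k\<in>{1..i}. Row d k) = {1..d i}"
proof (induction i)
  case 0
  then show ?case by (simp add: d_0)
next
  case (Suc i)
  have "(\<Union>k\<in>{1..Suc i}. Row d k) = (\<Union>k\<in>{1..i}. Row d k) \<union> Row d (Suc i)"
    by (auto simp: atLeastAtMostSuc_conv)
  also have "\<dots> = {1..d i} \<union> {d i<..d (Suc i)}"
    using Suc by (simp add: Row_def)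
  also have "\<dots> = {1..d (Suc i)}"
    using d_mono[of i "Suc i"] Suc.prems by auto
  finally show ?case .
qed

lemma Row_disjoint:
  assumes "k \<in> {1..r}" "k' \<in> {1..r}" "k \<noteq> k'"
  shows "Row d k \<inter> Row d k' = {}"
proof (rule ccontr)
  assume "Row d k \<inter> Row d k' \<noteq> {}"
  then obtain x where x: "x \<in> Row d k" "x \<in> Row d k'" by blast
  show False
    using Row_less[OF x] Row_less[OF x(2,1)] assms by (cases "k < k'") auto
qed

lemma finite_Row [simp]: "finite (Row d k)" by (simp add: Row_def)

lemma card_Row [simp]: "card (Row d k) = row_len d k"
  by (simp add: Row_def row_len_def)

lemma sum_row_len: "(\<Sum>k\<in>{1..r}. row_len d k) = n"
proof -
  have "card (\<Union>k\<in>{1..r}. Row d k) = (\<Sum>k\<in>{1..r}. card (Row d k))"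
    by (rule card_UN_disjoint) (use Row_disjoint in auto)
  then show ?thesis unfolding Row_UN[OF order_refl] by (simp add: d_r)
qed

definition prev_max :: "nat \<Rightarrow> nat" where
  "prev_max k = Max (insert 0 (row_len d ` {1..<k}))"

lemma Red_eq: "Red d k = {d (k - 1)<..d k - prev_max k}"
  by (auto simp: Red_def prev_max_def)

lemma Red_subset: "Red d k \<subseteq> Row d k"
  by (auto simp: Red_eq Row_def)

lemma Blue_subset: "Blue d k \<subseteq> Row d k"
  by (auto simp: Blue_def)

lemma finite_Red [simp]: "finite (Red d k)" using Red_subset finite_Row finite_subset by blast
lemma finite_Blue [simp]: "finite (Blue d k)" using Blue_subset finite_Row finite_subset by blast

lemma card_Red_Blue: "card (Red d k) + card (Blue d k) = row_len d k"
proof -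
  have "card (Red d k \<union> Blue d k) = card (Red d k) + card (Blue d k)"
    by (rule card_Un_disjoint) (auto simp: Blue_def)
  moreover have "Red d k \<union> Blue d k = Row d k" using Red_subset by (auto simp: Blue_def)
  ultimately show ?thesis by simp
qed

text \<open>
  A row has as many red boxes as it is longer than all rows above it, so these numbers telescope to
  the maximal row length.
\<close>

lemma sum_card_Red: "(\<Sum>k\<in>{1..<i + 1}. card (Red d k)) = prev_max (i + 1)"
proof (induction i)
  case 0
  show ?case by (simp add: prev_max_def)
next
  case (Suc i)
  have "prev_max (Suc i + 1) = Max (insert (row_len d (i + 1)) (insert 0 (row_len d ` {1..<i + 1})))"
    unfolding prev_max_def by (rule arg_cong[where f = Max]) (auto simp: atLeastLessThanSuc)
  also have "\<dots> = max (row_len d (i + 1)) (prev_max (i + 1))"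
    unfolding prev_max_def by (subst Max_insert) auto
  also have "\<dots> = prev_max (i + 1) + card (Red d (i + 1))"
    by (simp add: Red_eq row_len_def)
  finally show ?case using Suc by simp
qed

abbreviation "RED \<equiv> \<Union>k\<in>{1..r}. Red d k"
abbreviation "BLUE \<equiv> \<Union>k\<in>{1..r}. Blue d k"

lemma card_RED: "card RED = ncols r d"
proof -
  have "card RED = (\<Sum>k\<in>{1..r}. card (Red d k))"
    by (rule card_UN_disjoint) (use Row_disjoint Red_subset in fastforce)+
  also have "\<dots> = prev_max (r + 1)"
    using sum_card_Red[of r] by (simp add: atLeastLessThanSuc_atLeastAtMost)
  also have "\<dots> = ncols r d"
    unfolding prev_max_def ncols_def
    using r_pos by (subst Max_insert) (auto simp: atLeastLessThanSuc_atLeastAtMost)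
  finally show ?thesis .
qed

lemma RED_Un_BLUE: "RED \<union> BLUE = {1..n}"
proof -
  have "RED \<union> BLUE = (\<Union>k\<in>{1..r}. Row d k)" using Red_subset by (auto simp: Blue_def)
  then show ?thesis unfolding Row_UN[OF order_refl] by (simp add: d_r)
qed

lemma RED_Int_BLUE: "RED \<inter> BLUE = {}"
proof (rule ccontr)
  assume "RED \<inter> BLUE \<noteq> {}"
  then obtain x k k' where x: "k \<in> {1..r}" "k' \<in> {1..r}" "x \<in> Red d k" "x \<in> Blue d k'"
    unfolding UN_simps Int_iff ex_in_conv[symmetric] UN_iff by blast
  then have "k = k'" using Row_disjoint[of k k'] Red_subset Blue_subset by blast
  then show False using x by (auto simp: Blue_def)
qed

definition blue_rows :: "nat \<Rightarrow> nat list" where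
  "blue_rows i = concat (map (\<lambda>k. sorted_list_of_set (Blue d k)) (rev [1..<i + 1]))"

lemma blue_rows_Suc: "blue_rows (Suc i) = sorted_list_of_set (Blue d (Suc i)) @ blue_rows i"
  by (simp add: blue_rows_def)

lemma set_blue_rows: "set (blue_rows i) = (\<Union>k\<in>{1..i}. Blue d k)"
proof -
  have "{1..<i + 1} = {1..i}" by auto
  then show ?thesis by (simp add: blue_rows_def del: upt_Suc)
qed

lemma distinct_blue_rows: "i \<le> r \<Longrightarrow> distinct (blue_rows i)"
proof (induction i)
  case 0
  show ?case by (simp add: blue_rows_def)
next
  case (Suc i)
  have "Blue d (Suc i) \<inter> (\<Union>k\<in>{1..i}. Blue d k) = {}"
    using Row_disjoint[of "Suc i"] Blue_subset Suc.prems by fastforce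
  then show ?case using Suc by (simp add: blue_rows_Suc set_blue_rows)
qed

text \<open>
  The sequence \<open>l(1), \<dots>, l(s), m(1), \<dots>, m(n - s)\<close>.
\<close>

definition reading :: "nat list" where
  "reading = sorted_list_of_set RED @ blue_rows r"

lemma set_reading: "set reading = {1..n}"
  using RED_Un_BLUE by (simp add: reading_def set_blue_rows)

lemma distinct_reading: "distinct reading"
  using distinct_blue_rows[of r] RED_Int_BLUE by (simp add: reading_def set_blue_rows)

lemma length_reading: "length reading = n"
  using distinct_card[OF distinct_reading] by (simp add: set_reading)

lemma ncols_le: "ncols r d \<le> n"
proof -
  have "card RED \<le> card {1..n}" using RED_Un_BLUE by (intro card_mono) auto
  then show ?thesis using card_RED by simp
qed

text \<open>
  The column of the nonzero entry in row \<open>p\<close> of \<open>\<kappa>\<close>.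
\<close>

definition reading_perm :: "nat \<Rightarrow> nat" where
  "reading_perm p = (if p \<in> {1..n} then reading ! (p - 1) else p)"

lemma reading_perm_permutes: "reading_perm permutes {1..n}"
proof (rule bij_imp_permutes)
  have "bij_betw ((!) reading) {..<n} {1..n}"
    by (rule bij_betw_nth) (simp_all add: distinct_reading set_reading length_reading)
  moreover have "bij_betw (\<lambda>p. p - 1) {1..n} {..<n}"
    by (rule bij_betwI[where g = Suc]) auto
  ultimately have "bij_betw ((!) reading \<circ> (\<lambda>p. p - 1)) {1..n} {1..n}"
    by (rule bij_betw_trans[rotated])
  then show "bij_betw reading_perm {1..n} {1..n}"
    by (rule bij_betw_cong[THEN iffD1, rotated]) (simp add: reading_perm_def)
qed (auto simp: reading_perm_def)

lemma reading_perm_red: "p \<in> {1..ncols r d} \<Longrightarrow> reading_perm p = red_enum r d p"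
  using ncols_le card_RED by (auto simp: reading_perm_def reading_def red_enum_def nth_append)

lemma reading_perm_blue: "p \<in> {ncols r d<..n} \<Longrightarrow> reading_perm p = blue_enum r d (p - ncols r d)"
  using ncols_le card_RED by (auto simp: reading_perm_def reading_def blue_enum_def nth_append
      blue_rows_def)

lemma col_len_eq_0: "ncols r d < j \<Longrightarrow> col_len r d j = 0"
proof -
  assume "ncols r d < j"
  then have "\<not> j \<le> row_len d i" if "i \<in> {1..r}" for i
    using Max_ge[of "row_len d ` {1..r}" "row_len d i"] that
      \<open>ncols r d < j\<close> unfolding ncols_def by fastforce
  then have "{i \<in> {1..r}. j \<le> row_len d i} = {}" by blast
  then show ?thesis unfolding col_len_def by (simp only: card.empty)
qed

lemma col_len_antimono: "i \<le> j \<Longrightarrow> col_len r d j \<le> col_len r d i"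
  unfolding col_len_def by (rule card_mono) auto

text \<open>
  The two sums defining \<open>\<kappa>\<close> are covered by one formula for the exponents, since \<open>\<nu>\<^sub>p - 1 = -1\<close> for
  \<open>p > s\<close>.
\<close>

lemma kappa_eq_monomial_mat:
  "mat_sum n (\<lambda>i. tE n (int (col_len r d i) - 1) i (red_enum r d i)) {1..ncols r d}
   + mat_sum n (\<lambda>i. tE n (-1) (i + ncols r d) (blue_enum r d i)) {1..n - ncols r d}
   = (monomial_mat n (\<lambda>p. int (col_len r d p) - 1) reading_perm :: 'k::field fls mat)" (is "?R + ?B
       = ?A")
proof (rule eq_matI)
  fix i j assume "i < dim_row ?A" "j < dim_col ?A"
  then have ij: "i < n" "j < n" by (auto simp: monomial_mat_def)
  let ?s = "ncols r d"
  have "?R $$ (i, j) = (\<Sum>k\<in>{1..?s}. tE n (int (col_len r d k) - 1) k (red_enum r d k) $$ (i, j))"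
    by (rule index_mat_sum) (use ij in auto)
  also have "\<dots> = (\<Sum>k\<in>{1..?s}. if k = i + 1 then
      (if j + 1 = red_enum r d (i + 1) then fls_X_intpow (int (col_len r d (i
          + 1)) - 1) else 0) else 0)"
    by (rule sum.cong) (use ij in \<open>auto simp: index_tE\<close>)
  finally have R: "?R $$ (i, j) = (if i < ?s \<and> j + 1 = red_enum r d (i + 1)
      then fls_X_intpow (int (col_len r d (i + 1)) - 1) else 0)" by auto
  have "?B $$ (i, j) = (\<Sum>k\<in>{1..n - ?s}. tE n (- 1) (k + ?s) (blue_enum r d k) $$ (i, j))"
    by (rule index_mat_sum) (use ij in auto)
  also have "\<dots> = (\<Sum>k\<in>{1..n - ?s}. if k = i + 1 - ?s then
      (if ?s \<le> i \<and> j + 1 = blue_enum r d (i + 1 - ?s) then fls_X_intpow (-1) else 0) else 0)"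
    by (rule sum.cong) (use ij in \<open>auto simp: index_tE\<close>)
  finally have B: "?B $$ (i, j) = (if ?s \<le> i \<and> j + 1 = blue_enum r d (i + 1 - ?s)
      then fls_X_intpow (-1) else 0)" using ij by auto
  have "(?R + ?B) $$ (i, j) = ?R $$ (i, j) + ?B $$ (i, j)"
    using ij by (simp add: dim_mat_sum)
  then show "(?R + ?B) $$ (i, j) = ?A $$ (i, j)"
    using ij reading_perm_red[of "i + 1"] reading_perm_blue[of "i + 1"] col_len_eq_0[of "i + 1"]
    unfolding R B by (auto simp: monomial_mat_def)
qed (auto simp: monomial_mat_def dim_mat_sum)

text \<open>
  Double counting: both sides sum \<open>f\<close> of the column index over all boxes of the tableau.
\<close>

lemma sum_col_len:
  fixes f :: "nat \<Rightarrow> int"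
  shows "(\<Sum>j\<in>{1..n}. int (col_len r d j) * f j) = (\<Sum>k\<in>{1..r}. \<Sum>j\<in>{1..row_len d k}. f j)"
proof -
  have le: "row_len d k \<le> n" if "k \<in> {1..r}" for k
    using d_mono[of k r] that d_r by (auto simp: row_len_def)
  have "(\<Sum>j\<in>{1..n}. int (col_len r d j) * f j)
      = (\<Sum>j\<in>{1..n}. \<Sum>k\<in>{1..r}. if j \<le> row_len d k then f j else 0)"
    by (rule sum.cong) (auto simp: col_len_def sum.If_cases Int_def)
  also have "\<dots> = (\<Sum>k\<in>{1..r}. \<Sum>j\<in>{1..n}. if j \<le> row_len d k then f j else 0)"
    by (rule sum.swap)
  also have "\<dots> = (\<Sum>k\<in>{1..r}. \<Sum>j\<in>{1..row_len d k}. f j)"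
    by (rule sum.cong, simp, rule sum.mono_neutral_cong_right) (use le in auto)
  finally show ?thesis .
qed

lemma sum_col_len_1: "(\<Sum>j\<in>{1..n}. int (col_len r d j)) = int n"
  using sum_col_len[of "\<lambda>_. 1"] sum_row_len by (simp flip: of_nat_sum)

text \<open>
  The number of matrix positions below the diagonal blocks.
\<close>

definition flag_dim :: nat where
  "flag_dim = (\<Sum>k\<in>{1..r}. \<Sum>k'\<in>{1..<k}. row_len d k * row_len d k')"

text \<open>
  Summing the odd numbers \<open>2 j - 1\<close> over the boxes of the tableau gives the sum of the squared row
  lengths, which the squared total \<open>n\<^sup>2\<close> exceeds by twice the sum of the mixed products.
\<close>

lemma sum_pairs_col_len:
  "(\<Sum>(p, q)\<in>pairs n. int (col_len r d p) - int (col_len r d q)) = 2 * int flag_dim"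
proof -
  have "(\<Sum>(p, q)\<in>pairs n. int (col_len r d p) - int (col_len r d q))
     = (\<Sum>p\<in>{1..n}. int n * int (col_len r d p) - int (col_len r d p) * (2 * int p - 1))"
    unfolding sum_pairs_diff by (rule sum.cong) (auto simp: algebra_simps)
  also have "\<dots> = int n * int n - (\<Sum>k\<in>{1..r}. int (row_len d k) ^ 2)"
    by (subst sum_subtractf) (simp only: sum_distrib_left[symmetric] sum_col_len_1 sum_col_len
        sum_odd_numbers)
  also have "\<dots> = 2 * int flag_dim"
    using square_of_sum[of "\<lambda>k. int (row_len d k)" r] sum_row_len
    by (simp add: flag_dim_def power2_eq_square flip: of_nat_sum of_nat_mult)
  finally show ?thesis .
qed

lemma length_filter_blue_rows:
  assumes "i < k" "k \<le> r" "x \<in> Row d k"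
  shows "length (filter (\<lambda>y. y < x) (blue_rows i)) = (\<Sum>k'\<in>{1..<i + 1}. card (Blue d k'))"
proof -
  have "filter (\<lambda>y. y < x) (blue_rows i) = blue_rows i"
    using Row_less[of _ _ x k] assms Blue_subset by (intro filter_True) (fastforce simp: set_blue_rows)
  moreover have "length (blue_rows i) = (\<Sum>k'\<in>{1..<i + 1}. card (Blue d k'))"
    by (simp add: blue_rows_def length_concat comp_def rev_map[symmetric]
        interv_sum_list_conv_sum_set_nat)
  ultimately show ?thesis by simp
qed

text \<open>
  Blue rows are read from bottom to top, so the inversions are the pairs of blue boxes in different
  rows.
\<close>

lemma list_inversions_blue_rows:
  "i \<le> r \<Longrightarrow> list_inversions (blue_rows i)
      = (\<Sum>k\<in>{1..i}. card (Blue d k) * (\<Sum>k'\<in>{1..<k}. card (Blue d k')))"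
proof (induction i)
  case 0
  show ?case by (simp add: blue_rows_def)
next
  case (Suc i)
  have "(\<Sum>x\<leftarrow>sorted_list_of_set (Blue d (Suc i)). length (filter (\<lambda>y. y < x) (blue_rows i)))
     = (\<Sum>x\<in>Blue d (Suc i). length (filter (\<lambda>y. y < x) (blue_rows i)))"
    by (subst sum_list_distinct_conv_sum_set) auto
  also have "\<dots> = (\<Sum>x\<in>Blue d (Suc i). \<Sum>k'\<in>{1..<i + 1}. card (Blue d k'))"
    by (rule sum.cong, simp, rule length_filter_blue_rows[of _ "Suc i"])
        (use Suc.prems Blue_subset in auto)
  finally show ?case using Suc
      by (simp add: blue_rows_Suc list_inversions_append list_inversions_sorted)
qed

text \<open>
  Red boxes precede the blue boxes of their own row, hence the smaller blue boxes are those of the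
  rows above.
\<close>

lemma length_filter_blue_rows_red:
  assumes "k \<in> {1..r}" "x \<in> Red d k"
  shows "length (filter (\<lambda>y. y < x) (blue_rows r)) = (\<Sum>k'\<in>{1..<k}. card (Blue d k'))"
proof -
  have "length (filter (\<lambda>y. y < x) (blue_rows r)) = card {y \<in> set (blue_rows r). y < x}"
    using distinct_blue_rows[of r] by (metis distinct_card distinct_filter order_refl set_filter)
  also have "{y \<in> set (blue_rows r). y < x} = (\<Union>k'\<in>{1..<k}. Blue d k')"
  proof (intro equalityI subsetI)
    fix y assume "y \<in> {y \<in> set (blue_rows r). y < x}"
    then obtain k' where y: "k' \<in> {1..r}" "y \<in> Blue d k'" "y < x" by (auto simp: set_blue_rows)
    have "\<not> k < k'" using Row_less[of x k y k'] y assms Red_subset Blue_subset by fastforce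
    moreover have "k' \<noteq> k"
    proof
      assume "k' = k"
      then show False using y assms by (auto simp: Blue_def Red_eq Row_def)
    qed
    ultimately have "k' \<in> {1..<k}" using y by auto
    then show "y \<in> (\<Union>k'\<in>{1..<k}. Blue d k')" using y by blast
  next
    fix y assume "y \<in> (\<Union>k'\<in>{1..<k}. Blue d k')"
    then obtain k' where y: "k' \<in> {1..<k}" "y \<in> Blue d k'" by blast
    then have "y < x" using Row_less[of y k' x k] assms Red_subset Blue_subset by fastforce
    then show "y \<in> {y \<in> set (blue_rows r). y < x}" using y assms by (auto simp: set_blue_rows)
  qed
  also have "card \<dots> = (\<Sum>k'\<in>{1..<k}. card (Blue d k'))"
  proof (rule card_UN_disjoint)
    show "\<forall>i\<in>{1..<k}. \<forall>j\<in>{1..<k}. i \<noteq> j \<longrightarrow> Blue d i \<inter> Blue d j = {}"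
      using Row_disjoint Blue_subset assms by fastforce
  qed auto
  finally show ?thesis .
qed

lemma list_inversions_reading:
    "list_inversions reading = (\<Sum>k=1..r. \<Sum>k'=1..<k. card (Row d k) * card (Blue d k'))"
proof -
  have "list_inversions reading = list_inversions (blue_rows r)
      + (\<Sum>x\<in>RED. length (filter (\<lambda>y. y < x) (blue_rows r)))"
    by (simp add: reading_def list_inversions_append list_inversions_sorted
        sum_list_distinct_conv_sum_set)
  also have "(\<Sum>x\<in>RED. length (filter (\<lambda>y. y < x) (blue_rows r)))
      = (\<Sum>k\<in>{1..r}. \<Sum>x\<in>Red d k. length (filter (\<lambda>y. y < x) (blue_rows r)))"
    by (rule sum.UNION_disjoint) (use Row_disjoint Red_subset in fastforce)+
  also have "\<dots> = (\<Sum>k\<in>{1..r}. \<Sum>x\<in>Red d k. \<Sum>k'\<in>{1..<k}. card (Blue d k'))"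
    by (intro sum.cong refl length_filter_blue_rows_red)
  also have "list_inversions (blue_rows r) + \<dots> = (\<Sum>k\<in>{1..r}. (card (Red d k)
      + card (Blue d k)) * (\<Sum>k'\<in>{1..<k}. card (Blue d k')))"
    by (simp add: list_inversions_blue_rows sum.distrib algebra_simps)
  finally show ?thesis by (simp add: card_Red_Blue sum_distrib_left)
qed

text \<open>
  The exponents decrease weakly, so no term has to be replaced by its absolute value.
\<close>

lemma affine_inversions_kappa:
  "affine_inversions n (\<lambda>p. int (col_len r d p) - 1) reading_perm
   = 2 * int flag_dim + int (\<Sum>k=1..r. \<Sum>k'=1..<k. card (Row d k) * card (Blue d k'))"
proof -
  have "affine_inversions n (\<lambda>p. int (col_len r d p) - 1) reading_perm
     = (\<Sum>(p, q)\<in>pairs n. (int (col_len r d p) - int (col_len r d q))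
         + of_bool (reading ! (p - 1) > reading ! (q - 1)))"
    unfolding affine_inversions_def
  proof (rule sum.cong)
    fix x assume "x \<in> pairs n"
    then obtain p q where "x = (p, q)" "1 \<le> p" "p < q" "q \<le> n" by (auto simp: pairs_def)
    then show "\<bar>shi_term (\<lambda>p. int (col_len r d p) - 1) reading_perm x\<bar>
      = (case x of (p, q) \<Rightarrow> (int (col_len r d p) - int (col_len r d q))
          + of_bool (reading ! (p - 1) > reading ! (q - 1)))"
      using col_len_antimono[of p q] by (auto simp: shi_term_def reading_perm_def)
  qed simp
  also have "\<dots> = (\<Sum>(p, q)\<in>pairs n. int (col_len r d p) - int (col_len r d q))
      + (\<Sum>(p, q)\<in>pairs n. of_bool (reading ! (p - 1) > reading ! (q - 1)))"
    by (simp add: case_prod_unfold sum.distrib)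
  finally show ?thesis
    using sum_pairs_list_inversions[of reading]
        by (simp add: sum_pairs_col_len length_reading list_inversions_reading)
qed

lemma kappa_length:
  fixes \<kappa> :: "'k::field fls mat"
  assumes "\<kappa> = mat_sum n (\<lambda>i. tE n (int (col_len r d i) - 1) i (red_enum r d i)) {1..ncols r d}
   + mat_sum n (\<lambda>i. tE n (-1) (i + ncols r d) (blue_enum r d i)) {1..n - ncols r d}"
  shows "\<kappa> \<in> carrier (affine_weyl n)"
    "coxeter_length n \<kappa> = 2 * flag_dim + (\<Sum>k=1..r. \<Sum>k'=1..<k. card (Row d k) * card (Blue d k'))"
proof -
  have \<kappa>: "\<kappa> = monomial_mat n (\<lambda>p. int (col_len r d p) - 1) reading_perm"
    using assms kappa_eq_monomial_mat by simp
  have s: "(\<Sum>p\<in>{1..n}. int (col_len r d p) - 1) = 0"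
    using sum_col_len_1 by (simp add: sum_subtractf)
  show "\<kappa> \<in> carrier (affine_weyl n)"
    unfolding carrier_affine_weyl \<kappa> using reading_perm_permutes s by blast
  show "coxeter_length n \<kappa> = 2 * flag_dim + (\<Sum>k=1..r. \<Sum>k'=1..<k. card (Row d k) * card (Blue d k'))"
    using coxeter_length_monomial_mat[OF n_pos reading_perm_permutes s, where 'k
        = 'k] affine_inversions_kappa
    unfolding \<kappa> by linarith
qed

end

context composition begin

section \<open>The dimension of the partial flag variety\<close>

definition block_of :: "nat \<Rightarrow> nat" where
  "block_of j = (LEAST k. j < d k)"

lemma block_of:
  assumes "j < n"
  shows "block_of j \<in> {1..r}" "j < d (block_of j)" "d (block_of j - 1) \<le> j"
proof -
  show "j < d (block_of j)" unfolding block_of_def by (rule LeastI[of _ r]) (use assms d_r in simp)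
  then have "block_of j \<noteq> 0" using d_0 by (metis not_less0)
  moreover have "block_of j \<le> r" unfolding block_of_def by (rule Least_le) (use assms d_r in simp)
  ultimately show "block_of j \<in> {1..r}" by simp
  have "\<not> j < d (block_of j - 1)"
    using \<open>block_of j \<noteq> 0\<close> not_less_Least[of "block_of j - 1" "\<lambda>k. j < d k"] unfolding block_of_def
        by simp
  then show "d (block_of j - 1) \<le> j" by simp
qed

lemma block_of_eqI:
  assumes "k \<in> {1..r}" "d (k - 1) \<le> j" "j < d k"
  shows "block_of j = k"
  unfolding block_of_def
proof (rule Least_equality)
  fix k' assume "j < d k'"
  show "k \<le> k'"
  proof (rule ccontr)
    assume "\<not> k \<le> k'"
    then have "d k' \<le> d (k - 1)" using assms(1) by (intro d_mono) auto
    then show False using \<open>j < d k'\<close> assms(2) by simp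
  qed
qed (rule assms(3))

lemma block_of_less_iff:
  assumes "i < n" "j < n"
  shows "d (block_of j) \<le> i \<longleftrightarrow> block_of j < block_of i"
proof
  assume "d (block_of j) \<le> i"
  then have "d (block_of j) < d (block_of i)" using block_of(2)[OF assms(1)] by simp
  then show "block_of j < block_of i"
      using d_mono[of "block_of i" "block_of j"] block_of(1)[OF assms(2)]
      by (meson atLeastAtMost_iff leD not_le_imp_less)
next
  assume "block_of j < block_of i"
  then have "d (block_of j) \<le> d (block_of i - 1)" using block_of(1)[OF assms(1)] by (intro d_mono) auto
  then show "d (block_of j) \<le> i" using block_of(3)[OF assms(1)] by simp
qed

sublocale block_shape n "\<lambda>j. d (block_of j)"
proof
  show "j < d (block_of j)" if "j < n" for j using block_of(2)[OF that] .
  show "d (block_of j) \<le> n" if "j < n" for j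
      using d_mono[of "block_of j" r] block_of(1)[OF that] d_r by simp
  show "d (block_of i) \<le> d (block_of j)" if "j < n" "i < d (block_of j)" for i j
  proof (rule d_mono)
    show "block_of i \<le> block_of j" unfolding block_of_def[of i] by (rule Least_le) (rule that(2))
    show "block_of j \<le> r" using block_of(1)[OF that(1)] by simp
  qed
qed

lemma below_eq: "below = (\<Union>(k, k')\<in>(SIGMA k:{1..r}. {1..<k}). {d (k - 1)..<d k} \<times> {d (k' - 1)..<d k'})"
proof (intro equalityI subsetI)
  fix z assume "z \<in> below"
  then obtain i j where z: "z = (i, j)" "i < n" "j < n" "d (block_of j) \<le> i" by (auto simp: below_def)
  have "(block_of i, block_of j) \<in> (SIGMA k:{1..r}. {1..<k})"
    using block_of(1)[OF z(2)] block_of(1)[OF z(3)] block_of_less_iff[OF z(2,3)] z(4) by auto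
  moreover have "z \<in> {d (block_of i - 1)..<d (block_of i)} \<times> {d (block_of j - 1)..<d (block_of j)}"
    using z block_of[OF z(2)] block_of[OF z(3)] by simp
  ultimately show "z \<in> (\<Union>(k, k')\<in>(SIGMA k:{1..r}. {1..<k}). {d (k - 1)..<d k} \<times> {d (k' - 1)..<d k'})"
    by blast
next
  fix z assume "z \<in> (\<Union>(k, k')\<in>(SIGMA k:{1..r}. {1..<k}). {d (k - 1)..<d k} \<times> {d (k' - 1)..<d k'})"
  then obtain k k' i j where z: "z = (i, j)" "k \<in> {1..r}" "k' \<in> {1..<k}" "d (k - 1) \<le> i" "i < d k"
      "d (k' - 1) \<le> j" "j < d k'" by auto
  have b: "block_of i = k" "block_of j = k'" using z by (auto intro!: block_of_eqI)
  have "d k \<le> n" "d k' \<le> n" using z d_mono[of k r] d_mono[of k' r] d_r by auto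
  then have "i < n" "j < n" using z by auto
  then show "z \<in> below" using block_of_less_iff[of i j] b z by (auto simp: below_def)
qed

lemma card_below: "card below = flag_dim"
proof -
  let ?K = "SIGMA k:{1..r}. {1..<k}" and ?R = "\<lambda>(k, k'). {d (k - 1)..<d k} \<times> {d (k' - 1)..<d k'}"
  have "card below = (\<Sum>z\<in>?K. card (?R z))"
    unfolding below_eq
  proof (rule card_UN_disjoint)
    show "\<forall>x\<in>?K. \<forall>y\<in>?K. x \<noteq> y \<longrightarrow> ?R x \<inter> ?R y = {}"
    proof (intro ballI impI)
      fix x y assume xy: "x \<in> ?K" "y \<in> ?K" "x \<noteq> y"
      obtain k k' l l' where e: "x = (k, k')" "y = (l, l')" by (cases x, cases y)
      show "?R x \<inter> ?R y = {}"
      proof (rule ccontr)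
        assume "?R x \<inter> ?R y \<noteq> {}"
        then obtain i j where "i \<in> {d (k - 1)..<d k}" "i \<in> {d (l - 1)..<d l}"
            "j \<in> {d (k' - 1)..<d k'}" "j \<in> {d (l' - 1)..<d l'}" unfolding e by fast
        then have "k = l" "k' = l'"
          using block_of_eqI[of k i] block_of_eqI[of l i] block_of_eqI[of k' j] block_of_eqI[of l'
              j] xy(1,2) unfolding e by auto
        then show False using xy(3) e by simp
      qed
    qed
  qed auto
  also have "\<dots> = (\<Sum>k\<in>{1..r}. \<Sum>k'\<in>{1..<k}. row_len d k * row_len d k')"
    by (subst sum.Sigma) (auto simp: row_len_def intro!: sum.cong)
  finally show ?thesis by (simp add: flag_dim_def)
qed

lemma parabolic_eq_parab: "parabolic n r d = (parab :: 'k::field mat set)"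
proof (intro equalityI subsetI)
  fix A :: "'k mat" assume A: "A \<in> parabolic n r d"
  have "A $$ (i, j) = 0" if ij: "i < n" "j < n" "d (block_of j) \<le> i" for i j
  proof -
    have "Suc i \<in> Row d (block_of i)" "Suc j \<in> Row d (block_of j)"
      using block_of[OF ij(1)] block_of[OF ij(2)] by (auto simp: Row_def)
    moreover have "block_of i \<in> {1..r}" "block_of j \<in> {1..<block_of i}"
      using block_of(1)[OF ij(1)] block_of(1)[OF ij(2)] block_of_less_iff[OF ij(1,2)] ij(3) by auto
    ultimately have "A $$ (Suc i - 1, Suc j - 1) = 0" using A unfolding parabolic_def by blast
    then show ?thesis by simp
  qed
  then show "A \<in> parab" using A by (simp add: parab_def parabolic_def)
next
  fix A :: "'k mat" assume A: "A \<in> parab"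
  have "A $$ (a - 1, b - 1) = 0"
    if k: "k \<in> {1..r}" "k' \<in> {1..<k}" and ab: "a \<in> Row d k" "b \<in> Row d k'" for k k' a b
  proof -
    have b: "block_of (a - 1) = k" "block_of (b - 1) = k'" using k ab
        by (auto simp: Row_def intro!: block_of_eqI)
    have "d k \<le> n" "d k' \<le> n" using k d_mono[of k r] d_mono[of k' r] d_r by auto
    then have "a - 1 < n" "b - 1 < n" using ab by (auto simp: Row_def)
    then show ?thesis using A block_of_less_iff[of "a - 1" "b - 1"] b k by (simp add: parab_def)
  qed
  then show "A \<in> parabolic n r d" using parab_SL[OF A] unfolding parabolic_def by blast
qed

lemma krull_dim_coset_space:
  "krull_dim (coset_space n (parabolic n r d :: 'k::alg_closed_field mat set)) = enat flag_dim"
  unfolding parabolic_eq_parab using krull_dim_flag_space card_below by simp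

end

theorem lemma4p13:
  fixes n r s :: nat and d \<nu> l m :: "nat \<Rightarrow> nat"
    and P :: "'k::alg_closed_field mat set" and \<kappa> :: "'k fls mat"
  assumes "r > 0" and "d 0 = 0" and "strict_mono_on {0..r} d" and "d r = n"
    and "P = parabolic n r d"
    and "s = ncols r d" and "\<nu> = col_len r d"
    and "l = red_enum r d" and "m = blue_enum r d"
    and "\<kappa> = mat_sum n (\<lambda>i. tE n (int (\<nu> i) - 1) i (l i)) {1..s}
           + mat_sum n (\<lambda>i. tE n (-1) (i + s) (m i)) {1..n - s}"
  shows "\<kappa> \<in> carrier (affine_weyl n) \<and>
    enat (coxeter_length n \<kappa>) =
      2 * krull_dim (coset_space n P) +
      enat (\<Sum>k=1..r. \<Sum>k'=1..<k. card (Row d k) * card (Blue d k'))"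
proof -
  interpret composition n r d by unfold_locales fact+
  have \<kappa>: "\<kappa> = mat_sum n (\<lambda>i. tE n (int (col_len r d i) - 1) i (red_enum r d i)) {1..ncols r d}
     + mat_sum n (\<lambda>i. tE n (-1) (i + ncols r d) (blue_enum r d i)) {1..n - ncols r d}"
    using assms by simp
  show ?thesis
    unfolding \<open>P = parabolic n r d\<close> krull_dim_coset_space kappa_length(2)[OF \<kappa>]
    using kappa_length(1)[OF \<kappa>] by (simp add: numeral_eq_enat)
qed

end
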